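(* Let $\mathcal Z$ be a real separable Hilbert space. For $i=1,2$ let $F_i:\mathcal Z\to\mathcal Z$ be monotone and $L_{F_i}$-Lipschitz continuous and let $g_i\in\Gamma_0(\mathcal Z)$, with $\mathrm{dom}(g_1)\cap\mathrm{dom}(g_2)\neq\emptyset$. Let $\mathcal S_2=\mathrm{zer}(F_2+\partial g_2)$ and assume $\mathcal S_2\ne\emptyset$. Let $\mathcal S_1$ be the solution set of the hierarchical problem (see context) and assume $\mathcal S_1=\mathrm{zer}(F_1+\partial g_1+N_{\mathcal S_2})\neq\emptyset$. Assume that $\mathrm{dom}(g_1)\cap\mathrm{dom}(g_2)$ is closed and that for all compact sets $\mathcal A,\mathcal B\subset\mathrm{dom}(g_1)\cap\mathrm{dom}(g_2)$ one has $\sup_{(x,y)\in\mathcal A\times\mathcal B}|g_1(x)-g_1(y)|<\infty$. Let $a,b>0$, $\delta\in(0,1)$, $$\sigma_k=\frac{a}{(k+b)^\delta},\qquad t_k=t\ \ (k\ge1),\qquad 0<t\le\frac1{4(L_{F_2}+\sigma_1L_{F_1})}.$$ Assume additionally that at least one of the following holds: (1) for every $p\in\mathrm{Range}(N_{\mathcal S_2})$, $\ \sum_{k=1}^\infty t_k\big[\sup_{z\in\mathcal S_2}\varphi^{(F_2,g_2)}(z,\sigma_kp)-\mathtt s(\sigma_kp\,|\,\mathcal S_2)\big]<\infty$; (2) $\mathrm{dom}(g_1)\cap\mathrm{dom}(g_2)$ is compact. Let $z^1=z^{1/2}\in\mathcal Z$, let $(z^k),(z^{k+1/2})$ be generated by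 the optimistic extragradient method (see context), and put $\bar z^K=\frac1K\sum_{k=1}^K z^{k+1/2}$. Let $\mathcal U_2\subset\mathrm{dom}(g_1)\cap\mathrm{dom}(g_2)$ be nonempty and compact and let $\mathcal U_1\subset\mathrm{dom}(g_1)\cap\mathrm{dom}(g_2)$ be compact with $\mathcal U_1\cap\mathcal S_1\neq\emptyset$. Then there exist constants $C_{\mathcal U_2},C_{\mathcal U_1},B_{\mathcal U_1}>0$, independent of $K$, such that for all $K\ge1$: $$\Theta_{\rm Feas}(\bar z^K|\mathcal U_2)\le\frac{\sup_{z\in\mathcal U_2}\|z^1-z\|^2}{2Kt}+\frac{a\,C_{\mathcal U_2}}{(1-\delta)(K+b)^\delta},\qquad \Theta_{\rm Opt}(\bar z^K|\mathcal U_1\cap\mathcal S_2)\le\frac{C_{\mathcal U_1}}{a(K+b)^{1-\delta}},$$ and, if moreover $\mathcal S_2$ is $(\alpha,\rho)$-weakly sharp (with $\alpha>0$, $\rho\ge1$) and $\mathcal U_2\cap\mathcal S_2\ne\emptyset$, then for all $K\ge1$ (with the same constants) $$-B_{\mathcal U_1}\left[\frac{\sup_{z\in\mathcal U_2}\|z^1-z\|^2}{2Kt(\alpha/\rho)}+\frac{a\,C_{\mathcal U_2}}{(\alpha/\rho)(1-\delta)(K+b)^\delta}\right]^{1/\rho}\le\Theta_{\rm Opt}(\bar z^K|\mathcal U_1\cap\mathcal S_2).$$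
   Context: $\Gamma_0(\mathcal Z)$ is the class of proper convex lower semicontinuous functions $\mathcal Z\to(-\infty,+\infty]$; $\mathrm{dom}(g)=\{z: g(z)<\infty\}$; $\mathrm{zer}(A)=\{z:0\in A(z)\}$; $N_{\mathcal C}(z)=\{p:\langle p,z'-z\rangle\le0\ \forall z'\in\mathcal C\}$ for $z\in\mathcal C$ is the normal cone and $\mathrm{Range}(N_{\mathcal C})=\bigcup_{z\in\mathcal C}N_{\mathcal C}(z)$; $\mathtt s(p|\mathcal C)=\sup_{z\in\mathcal C}\langle p,z\rangle$ is the support function; $\mathrm{dist}(\cdot,\mathcal C)$ is the distance to $\mathcal C$; $\mathrm{prox}_G(u)=\mathrm{argmin}_{z}\{G(z)+\tfrac12\|z-u\|^2\}$. Hierarchical problem: find $z^*\in\mathcal S_2$ such that $\langle F_1(z^* ),z-z^*\rangle+g_1(z)-g_1(z^* )\ge0$ for all $z\in\mathcal S_2$, where $\mathcal S_2=\mathrm{zer}(F_2+\partial g_2)$. $\mathcal S_1$ denotes its set of solutions. Bifunction: $H^{(F,g)}(z,y)=\langle F(y),z-y\rangle+g(z)-g(y)$. Function $\varphi$: $\varphi^{(F_2,g_2)}(z,u)=\sup_{y\in\mathrm{dom}(g_2)}\{H^{(F_2,g_2)}(z,y)+\langle y,u\rangle\}$. Gap functions: $\Theta_{\rm Feas}(z|\mathcal U)=\sup_{y\in\mathcal U}H^{(F_2,g_2)}(z,y)$ and $\Theta_{\rm Opt}(z|\mathcal U\cap\mathcal S_2)=\sup_{y\in\mathcal U\cap\mathcal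 S_2}H^{(F_1,g_1)}(z,y)$. Weak sharpness: $\mathcal S_2$ is $(\alpha,\rho)$-weakly sharp, $\alpha>0$, $\rho\ge1$, if $H^{(F_2,g_2)}(z,z^* )\ge\frac\alpha\rho\,\mathrm{dist}(z,\mathcal S_2)^\rho$ for all $z^*\in\mathcal S_2$ and all $z\in\mathrm{dom}(g_2)$. Optimistic extragradient method: with $V_k=F_2+\sigma_kF_1$ and $G_k=g_2+\sigma_kg_1$, starting from $z^1=z^{1/2}$, for $k\ge1$: $$z^{k+1/2}=\mathrm{prox}_{t_kG_k}\big(z^k-t_kV_k(z^{k-1/2})\big),\qquad z^{k+1}=\mathrm{prox}_{t_kG_k}\big(z^k-t_kV_k(z^{k+1/2})\big).$$ *)

theory Defs
  imports "HOL-Analysis.Analysis"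
begin

text \<open>
  Extended-valued functions are modelled as \<^typ>\<open>'a \<Rightarrow> ereal\<close>. In \<^typ>\<open>ereal\<close>, \<open>\<infinity> - \<infinity>\<close> equals \<open>\<infinity>\<close>;
  differences \<open>g z - g y\<close> are only ever relevant for \<open>y\<close> in the effective domain of \<open>g\<close>.
\<close>

definition effective_dom :: "('a \<Rightarrow> ereal) \<Rightarrow> 'a set" where
  "effective_dom g = {z. g z < \<infinity>}"

definition proper_fun :: "('a \<Rightarrow> ereal) \<Rightarrow> bool" where
  "proper_fun g \<longleftrightarrow> (\<forall>z. g z \<noteq> -\<infinity>) \<and> effective_dom g \<noteq> {}"

definition convex_fun :: "('a::real_vector \<Rightarrow> ereal) \<Rightarrow> bool" where
  "convex_fun g \<longleftrightarrow> (\<forall>x y. \<forall>r\<in>{0<..<1}.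
     g ((1 - r) *\<^sub>R x + r *\<^sub>R y) \<le> ereal (1 - r) * g x + ereal r * g y)"

definition lsc_fun :: "('a::topological_space \<Rightarrow> ereal) \<Rightarrow> bool" where
  "lsc_fun g \<longleftrightarrow> (\<forall>z. g z \<le> Liminf (at z) g)"

definition Gamma0 :: "('a::real_normed_vector \<Rightarrow> ereal) set" where
  "Gamma0 = {g. proper_fun g \<and> convex_fun g \<and> lsc_fun g}"

definition monotone_op :: "('a::real_inner \<Rightarrow> 'a) \<Rightarrow> bool" where
  "monotone_op F \<longleftrightarrow> (\<forall>x y. inner (F x - F y) (x - y) \<ge> 0)"

definition subdiff :: "('a::real_inner \<Rightarrow> ereal) \<Rightarrow> 'a \<Rightarrow> 'a set" where
  "subdiff g z = {p. \<forall>y. g z + ereal (inner p (y - z)) \<le> g y}"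

definition normal_cone :: "'a::real_inner set \<Rightarrow> 'a \<Rightarrow> 'a set" where
  "normal_cone C z = (if z \<in> C then {p. \<forall>z'\<in>C. inner p (z' - z) \<le> 0} else {})"

definition op_range :: "('a \<Rightarrow> 'b set) \<Rightarrow> 'b set" where
  "op_range A = (\<Union>z. A z)"

definition zer :: "('a \<Rightarrow> 'b::zero set) \<Rightarrow> 'a set" where
  "zer A = {z. 0 \<in> A z}"

definition support_fun :: "'a::real_inner \<Rightarrow> 'a set \<Rightarrow> ereal" where
  "support_fun p C = (SUP z\<in>C. ereal (inner p z))"

definition prox :: "('a::real_normed_vector \<Rightarrow> ereal) \<Rightarrow> 'a \<Rightarrow> 'a" where
  "prox G u = (ARG_MIN (\<lambda>z. G z + ereal (1/2 * (norm (z - u))\<^sup>2)) z. True)"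

definition bifun :: "('a::real_inner \<Rightarrow> 'a) \<Rightarrow> ('a \<Rightarrow> ereal) \<Rightarrow> 'a \<Rightarrow> 'a \<Rightarrow> ereal" where
  "bifun F g z y = ereal (inner (F y) (z - y)) + g z - g y"

definition phi :: "('a::real_inner \<Rightarrow> 'a) \<Rightarrow> ('a \<Rightarrow> ereal) \<Rightarrow> 'a \<Rightarrow> 'a \<Rightarrow> ereal" where
  "phi F g z u = (SUP y\<in>effective_dom g. bifun F g z y + ereal (inner y u))"

text \<open>
  The sum of sets is the Minkowski sum. A solution of the hierarchical problem has to lie in
  the domain of \<open>g1\<close>, since otherwise \<open>g1 z - g1 zs\<close> is not meaningful.
\<close>

definition lower_sols :: "('a::real_inner \<Rightarrow> 'a) \<Rightarrow> ('a \<Rightarrow> ereal) \<Rightarrow> 'a set" where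
  "lower_sols F2 g2 = zer (\<lambda>z. {F2 z} + subdiff g2 z)"

definition hierarchical_sols ::
  "('a::real_inner \<Rightarrow> 'a) \<Rightarrow> ('a \<Rightarrow> ereal) \<Rightarrow> ('a \<Rightarrow> 'a) \<Rightarrow> ('a \<Rightarrow> ereal) \<Rightarrow> 'a set" where
  "hierarchical_sols F1 g1 F2 g2 =
     {zs \<in> lower_sols F2 g2 \<inter> effective_dom g1.
        \<forall>z\<in>lower_sols F2 g2. ereal (inner (F1 zs) (z - zs)) + g1 z - g1 zs \<ge> 0}"

definition gap :: "('a::real_inner \<Rightarrow> 'a) \<Rightarrow> ('a \<Rightarrow> ereal) \<Rightarrow> 'a set \<Rightarrow> 'a \<Rightarrow> ereal" where
  "gap F g U z = (SUP y\<in>U. bifun F g z y)"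

definition weakly_sharp ::
  "('a::real_inner \<Rightarrow> 'a) \<Rightarrow> ('a \<Rightarrow> ereal) \<Rightarrow> real \<Rightarrow> real \<Rightarrow> bool" where
  "weakly_sharp F2 g2 \<alpha> \<rho> \<longleftrightarrow> \<alpha> > 0 \<and> \<rho> \<ge> 1 \<and>
     (\<forall>zs\<in>lower_sols F2 g2. \<forall>z\<in>effective_dom g2.
        bifun F2 g2 z zs \<ge> ereal (\<alpha> / \<rho> * infdist z (lower_sols F2 g2) powr \<rho>))"

text \<open>
  Half-integer indices are encoded by a second sequence: \<open>w k\<close> stands for \<open>z^(k+1/2)\<close>, so that
  \<open>w 0\<close> is the initial point \<open>z^(1/2)\<close>; \<open>z 0\<close> is irrelevant.
\<close>

definition optimistic_extragradient ::
  "('a::real_inner \<Rightarrow> 'a) \<Rightarrow> ('a \<Rightarrow> ereal) \<Rightarrow> ('a \<Rightarrow> 'a) \<Rightarrow> ('a \<Rightarrow> ereal) \<Rightarrow>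
   (nat \<Rightarrow> real) \<Rightarrow> (nat \<Rightarrow> real) \<Rightarrow> (nat \<Rightarrow> 'a) \<Rightarrow> (nat \<Rightarrow> 'a) \<Rightarrow> bool" where
  "optimistic_extragradient F1 g1 F2 g2 \<sigma> t z w \<longleftrightarrow>
     (let V = (\<lambda>k x. F2 x + \<sigma> k *\<^sub>R F1 x);
          G = (\<lambda>k x. g2 x + ereal (\<sigma> k) * g1 x)
      in w 0 = z 1 \<and>
         (\<forall>k\<ge>1.
            w k = prox (\<lambda>x. ereal (t k) * G k x) (z k - t k *\<^sub>R V k (w (k - 1))) \<and>
            z (k + 1) = prox (\<lambda>x. ereal (t k) * G k x) (z k - t k *\<^sub>R V k (w k))))"

end

theory Submission
  imports Defs
begin

text \<open>
  The method is a perturbed extragradient scheme, and everything rests on one energy inequality.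
  For a point \<open>y\<close> in both domains let the energy at index \<open>k\<close> be the squared distance of \<open>z k\<close>
  to \<open>y\<close> plus half the squared distance of \<open>z k\<close> to \<open>w (k - 1)\<close>. The variational inequalities
  of the two proximal steps show (\<open>optimistic_step\<close>) that in each step the energy grows by at
  most \<open>2 * t\<close> times \<open>H2 y (w k) + \<sigma> k * H1 y (w k)\<close>, where \<open>H1\<close> and \<open>H2\<close> are the bifunctions
  of the two levels. By monotonicity this is at most \<open>- H2 (w k) y - \<sigma> k * H1 (w k) y\<close>
  (\<open>energy_descent\<close>). The proximal points exist because a minimising sequence of a strongly
  convex function is Cauchy (\<open>Gamma0_prox_minimizer\<close>).

  The iterates are bounded. This is immediate if the common domain is compact. Otherwise take
  for \<open>y\<close> a solution with multiplier \<open>p\<close> in the normal cone of the lower-level solution set;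
  then \<open>H1 y (w k)\<close> is at most \<open>inner p (w k - y)\<close>, and the growth of the energy in step \<open>k\<close>
  is at most twice a term of the series that is assumed to be finite (\<open>energy_increment_le_phi\<close>).

  Given bounded iterates, \<open>- H1 (w k) y\<close> is bounded uniformly in \<open>k\<close> and in \<open>y\<close> from a compact
  set, where the lower bound on \<open>g1\<close> along the iterates comes from a linear minorant
  (\<open>Gamma0_linear_lower_bound\<close>). Summing the energy inequality and using convexity for the
  average bounds the feasibility gap by the initial distance plus the mean of the \<open>\<sigma> k\<close>
  (\<open>feasibility_bound\<close>), which is of order \<open>K powr - \<delta>\<close>. If \<open>y\<close> solves the lower level, then
  \<open>H2 (w k) y\<close> is nonnegative, and dividing by \<open>\<sigma> k\<close> before summing, with summation by parts,
  bounds the optimality gap by a multiple of \<open>1 / (K * \<sigma> K)\<close> (\<open>optimality_bound\<close>).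

  For the lower bound, the multiplier gives \<open>H1 (zbar K) y \<ge> - inner p (zbar K - y)\<close>, and a
  normal functional grows at most by its norm times the distance to the set
  (\<open>normal_cone_inner_le_infdist\<close>). Weak sharpness bounds this distance by the feasibility gap.
\<close>

section \<open>Proper convex lower semicontinuous functions\<close>

text \<open>
  Extended arithmetic is left as early as possible: on its domain a proper function equals the
  real number \<open>val g x\<close>. Outside the domain that number is a default without meaning, so
  comparisons of values are made at points of the domain.
\<close>
abbreviation val :: "('a \<Rightarrow> ereal) \<Rightarrow> 'a \<Rightarrow> real" where
  "val g x \<equiv> real_of_ereal (g x)"

text \<open>
  The lower limit of the definition ignores the point itself, where the inequality is
  trivial; neighbourhoods including the point compose directly with convergent sequences.
\<close>
lemma lsc_fun_iff:
  "lsc_fun g \<longleftrightarrow> (\<forall>z c. c < g z \<longrightarrow> (\<forall>\<^sub>F x in nhds z. c < g x))"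
  unfolding lsc_fun_def le_Liminf_iff eventually_nhds_conv_at by blast

lemma Gamma0_not_MInf: "g \<in> Gamma0 \<Longrightarrow> g x \<noteq> -\<infinity>"
  by (auto simp: Gamma0_def proper_fun_def)

lemma Gamma0_val:
  assumes "g \<in> Gamma0" "x \<in> effective_dom g"
  shows "g x = ereal (val g x)"
  using assms Gamma0_not_MInf[OF assms(1), of x]
  by (cases "g x") (auto simp: effective_dom_def)

lemma Gamma0_convex_on_val:
  assumes "g \<in> Gamma0"
  shows "convex_on (effective_dom g) (val g)"
proof -
  have main: "(1 - r) *\<^sub>R x + r *\<^sub>R y \<in> effective_dom g \<and>
      val g ((1 - r) *\<^sub>R x + r *\<^sub>R y) \<le> (1 - r) * val g x + r * val g y"
    if "x \<in> effective_dom g" "y \<in> effective_dom g" "0 < r" "r < 1" for x y r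
  proof -
    have le: "g ((1 - r) *\<^sub>R x + r *\<^sub>R y) \<le> ereal ((1 - r) * val g x + r * val g y)"
    proof -
      have "g ((1 - r) *\<^sub>R x + r *\<^sub>R y) \<le> ereal (1 - r) * g x + ereal r * g y"
        using assms that by (auto simp: Gamma0_def convex_fun_def)
      also have "\<dots> = ereal ((1 - r) * val g x + r * val g y)"
        by (subst (1 2) Gamma0_val[OF assms]) (use that in auto)
      finally show ?thesis .
    qed
    then have dom: "(1 - r) *\<^sub>R x + r *\<^sub>R y \<in> effective_dom g"
      by (auto simp: effective_dom_def)
    with le show ?thesis
      using Gamma0_val[OF assms dom] by (metis ereal_less_eq(3))
  qed
  show ?thesis
  proof (rule convex_onI)
    show "convex (effective_dom g)"
      unfolding convex_alt
    proof (intro ballI allI impI)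
      fix x y u assume "x \<in> effective_dom g" "y \<in> effective_dom g" "0 \<le> u \<and> (u::real) \<le> 1"
      then show "(1 - u) *\<^sub>R x + u *\<^sub>R y \<in> effective_dom g"
        using main[of x y u] by (cases "u = 0"; cases "u = 1") auto
    qed
  qed (use main in auto)
qed

text \<open>
  This lets lower semicontinuity pass to sums: a strict lower bound on a sum is implied by
  strict real lower bounds on the summands, also when a summand is infinite.
\<close>
lemma ereal_less_add_split:
  fixes A B c :: ereal
  assumes "c < A + B" "A \<noteq> -\<infinity>" "B \<noteq> -\<infinity>"
  shows "\<exists>c1 c2. ereal c1 < A \<and> ereal c2 < B \<and> c \<le> ereal (c1 + c2)"
proof -
  obtain d where d: "c < ereal d" "ereal d < A + B"
    using ereal_dense2[OF assms(1)] by blast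
  consider (fin) p q where "A = ereal p" "B = ereal q" | (inf1) p where "A = ereal p" "B = \<infinity>"
    | (inf2) q where "A = \<infinity>" "B = ereal q" | (inf) "A = \<infinity>" "B = \<infinity>"
    using assms by (cases A; cases B) auto
  then show ?thesis
  proof cases
    case fin
    show ?thesis
      using fin d
      by (intro exI[of _ "p - (p + q - d) / 2"] exI[of _ "q - (p + q - d) / 2"])
        (auto simp: field_simps less_imp_le)
  next
    case inf1
    then show ?thesis
      using d by (intro exI[of _ "p - 1"] exI[of _ "d - p + 1"]) (auto simp: less_imp_le)
  next
    case inf2
    then show ?thesis
      using d by (intro exI[of _ "d - q + 1"] exI[of _ "q - 1"]) (auto simp: less_imp_le)
  next
    case inf
    then show ?thesis
      using d by (intro exI[of _ d] exI[of _ 0]) (auto simp: less_imp_le)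
  qed
qed

lemma effective_dom_add:
  assumes "f \<in> Gamma0" "h \<in> Gamma0"
  shows "effective_dom (\<lambda>x. f x + h x) = effective_dom f \<inter> effective_dom h"
  using Gamma0_not_MInf[OF assms(1)] Gamma0_not_MInf[OF assms(2)]
  by (auto simp: effective_dom_def)

lemma effective_dom_scale:
  assumes "c > 0"
  shows "effective_dom (\<lambda>x. ereal c * g x) = effective_dom g"
  using assms by (auto simp: effective_dom_def)

lemma ereal_pos_distrib_left:
  fixes A B :: ereal
  assumes "c > 0"
  shows "ereal c * (A + B) = ereal c * A + ereal c * B"
  using assms by (cases A; cases B) (auto simp: distrib_left)

lemma Gamma0_add:
  fixes f h :: "'a::real_normed_vector \<Rightarrow> ereal"
  assumes f: "f \<in> Gamma0" and h: "h \<in> Gamma0"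
    and ne: "effective_dom f \<inter> effective_dom h \<noteq> {}"
  shows "(\<lambda>x. f x + h x) \<in> Gamma0"
  unfolding Gamma0_def mem_Collect_eq
proof (intro conjI)
  show "proper_fun (\<lambda>x. f x + h x)"
    using ne Gamma0_not_MInf[OF f] Gamma0_not_MInf[OF h]
    by (auto simp: proper_fun_def effective_dom_add[OF f h])
  show "convex_fun (\<lambda>x. f x + h x)"
    unfolding convex_fun_def
  proof (intro allI ballI)
    fix x y :: 'a and r :: real assume r: "r \<in> {0<..<1}"
    let ?p = "(1 - r) *\<^sub>R x + r *\<^sub>R y"
    have "f ?p + h ?p \<le> (ereal (1 - r) * f x + ereal r * f y) + (ereal (1 - r) * h x + ereal r * h y)"
      using f h r by (intro add_mono) (auto simp: Gamma0_def convex_fun_def)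
    also have "\<dots> = ereal (1 - r) * (f x + h x) + ereal r * (f y + h y)"
      using r by (simp add: ereal_pos_distrib_left add_ac)
    finally show "f ?p + h ?p \<le> ereal (1 - r) * (f x + h x) + ereal r * (f y + h y)" .
  qed
  have lf: "\<And>z c. c < f z \<Longrightarrow> \<forall>\<^sub>F x in nhds z. c < f x" and lh: "\<And>z c. c < h z \<Longrightarrow> \<forall>\<^sub>F x in nhds z. c < h x"
    using f h by (auto simp: Gamma0_def lsc_fun_iff)
  show "lsc_fun (\<lambda>x. f x + h x)"
    unfolding lsc_fun_iff
  proof (intro allI impI)
    fix z c assume "c < f z + h z"
    then obtain c1 c2 where c: "ereal c1 < f z" "ereal c2 < h z" "c \<le> ereal (c1 + c2)"
      using ereal_less_add_split Gamma0_not_MInf[OF f] Gamma0_not_MInf[OF h] by blast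
    from lf[OF c(1)] lh[OF c(2)] show "\<forall>\<^sub>F x in nhds z. c < f x + h x"
    proof eventually_elim
      case (elim x)
      then have "ereal c1 + ereal c2 < f x + h x"
        by (intro ereal_add_strict_mono2)
      with c(3) show ?case by (auto intro: le_less_trans)
    qed
  qed
qed

lemma Gamma0_scale:
  fixes g :: "'a::real_normed_vector \<Rightarrow> ereal"
  assumes g: "g \<in> Gamma0" and c: "c > 0"
  shows "(\<lambda>x. ereal c * g x) \<in> Gamma0"
  unfolding Gamma0_def mem_Collect_eq
proof (intro conjI)
  show "proper_fun (\<lambda>x. ereal c * g x)"
    using g c by (auto simp: Gamma0_def proper_fun_def effective_dom_scale)
  show "convex_fun (\<lambda>x. ereal c * g x)"
    unfolding convex_fun_def
  proof (intro allI ballI)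
    fix x y :: 'a and r :: real assume r: "r \<in> {0<..<1}"
    let ?p = "(1 - r) *\<^sub>R x + r *\<^sub>R y"
    have "ereal c * g ?p \<le> ereal c * (ereal (1 - r) * g x + ereal r * g y)"
      using g r c by (intro ereal_mult_left_mono) (auto simp: Gamma0_def convex_fun_def)
    also have "\<dots> = ereal (1 - r) * (ereal c * g x) + ereal r * (ereal c * g y)"
      using c by (simp only: ereal_pos_distrib_left mult.left_commute)
    finally show "ereal c * g ?p \<le> ereal (1 - r) * (ereal c * g x) + ereal r * (ereal c * g y)" .
  qed
  show "lsc_fun (\<lambda>x. ereal c * g x)"
    unfolding lsc_fun_def
  proof
    fix z
    have le: "g z \<le> Liminf (at z) g"
      using g by (auto simp: Gamma0_def lsc_fun_def)
    show "ereal c * g z \<le> Liminf (at z) (\<lambda>x. ereal c * g x)"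
    proof (cases "at z = bot")
      case True
      then show ?thesis by (simp add: le_Liminf_iff)
    next
      case False
      then show ?thesis
        using c le by (simp add: Liminf_ereal_mult_left ereal_mult_left_mono)
    qed
  qed
qed

text \<open>
  Lower semicontinuity bounds \<open>g\<close> from below on a ball around a point \<open>x0\<close> of the domain. A
  point \<open>x\<close> outside the ball is reached by a segment from \<open>x0\<close>, which leaves the ball at
  distance \<open>d\<close>; convexity on that segment transports the bound to \<open>x\<close>, with a loss
  proportional to \<open>norm (x - x0) / d\<close>. The resulting minorant is a cone with apex \<open>x0\<close>.
\<close>
lemma Gamma0_linear_lower_bound:
  assumes g: "g \<in> Gamma0"
  shows "\<exists>A B. B \<ge> 0 \<and> (\<forall>x\<in>effective_dom g. A - B * norm x \<le> val g x)"
proof -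
  obtain x0 where x0: "x0 \<in> effective_dom g"
    using g by (auto simp: Gamma0_def proper_fun_def)
  let ?v = "val g x0"
  have "ereal (?v - 1) < g x0"
    using Gamma0_val[OF g x0] by (metis less_add_one less_ereal.simps(1) diff_less_eq)
  then have "\<forall>\<^sub>F x in nhds x0. ereal (?v - 1) < g x"
    using g by (auto simp: Gamma0_def lsc_fun_iff)
  then obtain e where e: "e > 0" "\<And>x. dist x x0 < e \<Longrightarrow> ereal (?v - 1) < g x"
    unfolding eventually_nhds_metric by blast
  define d where "d = e / 2"
  have d: "d > 0" "\<And>x. norm (x - x0) \<le> d \<Longrightarrow> x \<in> effective_dom g \<Longrightarrow> ?v - 1 \<le> val g x"
  proof -
    show "d > 0" using e by (simp add: d_def)
    fix x assume "norm (x - x0) \<le> d" "x \<in> effective_dom g"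
    then have "ereal (?v - 1) < ereal (val g x)"
      using e Gamma0_val[OF g, of x] by (simp add: d_def dist_norm)
    then show "?v - 1 \<le> val g x" by simp
  qed
  have bound: "?v - 1 - norm (x - x0) / d \<le> val g x" if x: "x \<in> effective_dom g" for x
  proof (cases "norm (x - x0) \<le> d")
    case True
    with d(2)[OF _ x] have "?v - 1 \<le> val g x" by simp
    moreover have "norm (x - x0) / d \<ge> 0" using d by simp
    ultimately show ?thesis by linarith
  next
    case False
    \<comment> \<open>The point \<open>?y\<close> is where the segment from \<open>x0\<close> to \<open>x\<close> crosses the sphere of radius \<open>d\<close>.\<close>
    define s where "s = d / norm (x - x0)"
    have "norm (x - x0) > 0" using False d(1) by linarith
    then have s: "0 < s" "s < 1" using False d(1) by (simp_all add: s_def field_simps)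
    let ?y = "(1 - s) *\<^sub>R x0 + s *\<^sub>R x"
    have yx: "?y - x0 = s *\<^sub>R (x - x0)" by (simp add: algebra_simps)
    have "norm (?y - x0) = d" unfolding yx using False d(1) by (auto simp: s_def)
    moreover have "?y \<in> effective_dom g"
      using Gamma0_convex_on_val[OF g] x x0 s by (auto simp: convex_on_def convex_alt)
    ultimately have "?v - 1 \<le> val g ?y" using d by simp
    also have "\<dots> \<le> (1 - s) * ?v + s * val g x"
      using convex_onD[OF Gamma0_convex_on_val[OF g], of s x0 x] x x0 s by simp
    finally have "?v * s - 1 \<le> val g x * s" by (simp add: algebra_simps)
    then have "?v - 1 / s \<le> val g x" using s by (simp add: field_simps)
    then show ?thesis by (simp add: s_def)
  qed
  have "(?v - 1 - norm x0 / d) - 1 / d * norm x \<le> val g x" if x: "x \<in> effective_dom g" for x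
  proof -
    have "norm (x - x0) / d \<le> (norm x + norm x0) / d"
      using d norm_triangle_ineq4[of x x0] by (intro divide_right_mono) auto
    then show ?thesis using bound[OF x] by (simp add: add_divide_distrib)
  qed
  then show ?thesis using d(1) by (intro exI[of _ "?v - 1 - norm x0 / d"] exI[of _ "1 / d"]) auto
qed

section \<open>The proximal map\<close>

text \<open>
  In infinite dimension bounded sequences need not have convergent subsequences; strong
  convexity replaces compactness. By the parallelogram law the value at the midpoint
  of two almost-minimisers would lie below the infimum if they were far apart, so a minimising
  sequence is Cauchy, and lower semicontinuity makes its limit a minimiser. The linear
  minorant guarantees that the infimum is finite.
\<close>
lemma Gamma0_prox_minimizer:
  fixes u :: "'a::{real_inner, complete_space}"
  assumes g: "g \<in> Gamma0"
  shows "\<exists>p\<in>effective_dom g. \<forall>x\<in>effective_dom g.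
    val g p + 1/2 * (norm (p - u))\<^sup>2 \<le> val g x + 1/2 * (norm (x - u))\<^sup>2"
proof -
  let ?D = "effective_dom g"
  define Q where "Q x = val g x + 1/2 * (norm (x - u))\<^sup>2" for x
  define m where "m = (INF x\<in>?D. Q x)"
  have ne: "?D \<noteq> {}" using g by (auto simp: Gamma0_def proper_fun_def)
  obtain A B where AB: "B \<ge> 0" "\<And>x. x \<in> ?D \<Longrightarrow> A - B * norm x \<le> val g x"
    using Gamma0_linear_lower_bound[OF g] by blast
  \<comment> \<open>The worst loss \<open>B * norm (x - u)\<close> is absorbed by the quadratic up to \<open>B\<^sup>2 / 2\<close>.\<close>
  have "A - B * norm u - B\<^sup>2 / 2 \<le> Q x" if "x \<in> ?D" for x
  proof -
    have "B * norm x \<le> B * (norm u + norm (x - u))"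
      using AB(1) norm_triangle_ineq[of u "x - u"] by (intro mult_left_mono) auto
    moreover have "0 \<le> (B - norm (x - u))\<^sup>2" by simp
    ultimately show ?thesis
      using AB(2)[OF that] unfolding Q_def by (simp add: power2_eq_square algebra_simps)
  qed
  then have bdd: "bdd_below (Q ` ?D)" by (intro bdd_belowI2)
  have m_le: "m \<le> Q x" if "x \<in> ?D" for x
    unfolding m_def using bdd that by (rule cINF_lower)
  have "\<exists>x\<in>?D. Q x < m + 1 / real (Suc n)" for n
    using cINF_less_iff[OF ne bdd, of "m + 1 / real (Suc n)"] by (simp add: m_def)
  then obtain X where X: "\<And>n. X n \<in> ?D" "\<And>n. Q (X n) < m + 1 / real (Suc n)"
    by metis
  have close: "(norm (X i - X j))\<^sup>2 \<le> 4 * (1 / real (Suc i) + 1 / real (Suc j))" for i j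
  proof -
    let ?y = "(1 - 1/2) *\<^sub>R X i + (1/2::real) *\<^sub>R X j"
    have y: "?y \<in> ?D"
      using Gamma0_convex_on_val[OF g] X unfolding convex_on_def convex_alt
      by (metis half_gt_zero_iff less_eq_real_def zero_less_one field_sum_of_halves le_add_same_cancel1)
    have c: "val g ?y \<le> (1 - 1/2) * val g (X i) + 1/2 * val g (X j)"
      using convex_onD[OF Gamma0_convex_on_val[OF g], of "1/2" "X i" "X j"] X by simp
    have "?y - u = (1/2) *\<^sub>R ((X i - u) + (X j - u))"
      by (simp add: algebra_simps flip: scaleR_add_left)
    then have "(norm (?y - u))\<^sup>2 = 1/4 * (norm ((X i - u) + (X j - u)))\<^sup>2"
      by (simp add: power2_eq_square)
    moreover have "(norm ((X i - u) + (X j - u)))\<^sup>2 = 2 * (norm (X i - u))\<^sup>2 + 2 * (norm (X j - u))\<^sup>2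
       - (norm (X i - X j))\<^sup>2"
      by (simp add: power2_norm_eq_inner algebra_simps inner_commute)
    ultimately have "Q ?y \<le> 1/2 * Q (X i) + 1/2 * Q (X j) - 1/8 * (norm (X i - X j))\<^sup>2"
      using c unfolding Q_def by (simp add: field_simps)
    with m_le[OF y] X(2)[of i] X(2)[of j] show ?thesis by argo
  qed
  have "Cauchy X"
  proof (rule metric_CauchyI)
    fix e :: real assume e: "e > 0"
    then obtain N :: nat where N: "8 / e\<^sup>2 < real N" using reals_Archimedean2 by blast
    have "dist (X i) (X j) < e" if "i \<ge> N" "j \<ge> N" for i j
    proof -
      have small: "1 / real (Suc k) < e\<^sup>2 / 8" if "k \<ge> N" for k
      proof -
        have "8 / e\<^sup>2 < real (Suc k)" using N that by linarith
        then show ?thesis using e by (simp add: field_simps)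
      qed
      have "(norm (X i - X j))\<^sup>2 < e\<^sup>2"
        using close[of i j] small[OF that(1)] small[OF that(2)] by argo
      then show ?thesis
        using e by (simp add: dist_norm power2_less_imp_less)
    qed
    then show "\<exists>M. \<forall>i\<ge>M. \<forall>j\<ge>M. dist (X i) (X j) < e" by blast
  qed
  then obtain p where p: "X \<longlonglongrightarrow> p" using Cauchy_convergent convergent_def by blast
  have gp: "g p \<le> ereal (m - 1/2 * (norm (p - u))\<^sup>2)"
  proof (rule ccontr)
    assume "\<not> ?thesis"
    then obtain c where c: "m - 1/2 * (norm (p - u))\<^sup>2 < c" "ereal c < g p"
      using ereal_dense2 by (metis linorder_not_le ereal_less_ereal_Ex less_ereal.simps(1))
    have "\<forall>\<^sub>F x in nhds p. ereal c < g x"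
      using g c(2) by (auto simp: Gamma0_def lsc_fun_iff)
    then have ev: "\<forall>\<^sub>F n in sequentially. ereal c < g (X n)"
      using p by (rule eventually_compose_filterlim)
    have "\<forall>\<^sub>F n in sequentially. c + 1/2 * (norm (X n - u))\<^sup>2 \<le> m + 1 / real (Suc n)"
      using ev
    proof eventually_elim
      case (elim n)
      then have "ereal c < ereal (val g (X n))" using Gamma0_val[OF g X(1)] by metis
      then show ?case using X(2)[of n] by (simp add: Q_def)
    qed
    moreover have "(\<lambda>n. c + 1/2 * (norm (X n - u))\<^sup>2) \<longlonglongrightarrow> c + 1/2 * (norm (p - u))\<^sup>2"
      by (intro tendsto_intros p)
    moreover have "(\<lambda>n. m + 1 / real (Suc n)) \<longlonglongrightarrow> m + 0"
      by (intro tendsto_add tendsto_const LIMSEQ_Suc[OF lim_1_over_n])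
    ultimately have "c + 1/2 * (norm (p - u))\<^sup>2 \<le> m"
      using tendsto_le[OF sequentially_bot, of _ "m + 0"] by fastforce
    with c show False by simp
  qed
  then have pD: "p \<in> ?D" by (auto simp: effective_dom_def)
  then have "val g p \<le> m - 1/2 * (norm (p - u))\<^sup>2" using gp Gamma0_val[OF g pD] by (metis ereal_less_eq(3))
  then show ?thesis using pD m_le unfolding Q_def by (intro bexI[of _ p]) fastforce+
qed

lemma prox_minimizes:
  fixes u :: "'a::{real_inner, complete_space}"
  assumes g: "g \<in> Gamma0"
  shows "prox g u \<in> effective_dom g"
    and "x \<in> effective_dom g \<Longrightarrow>
      val g (prox g u) + 1/2 * (norm (prox g u - u))\<^sup>2 \<le> val g x + 1/2 * (norm (x - u))\<^sup>2"
proof -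
  define h where "h x = g x + ereal (1/2 * (norm (x - u))\<^sup>2)" for x
  have h: "h x = ereal (val g x + 1/2 * (norm (x - u))\<^sup>2)" if "x \<in> effective_dom g" for x
    unfolding h_def by (subst Gamma0_val[OF g that]) simp
  have hinf: "h x = \<infinity>" if "x \<notin> effective_dom g" for x
    using that by (simp add: h_def effective_dom_def)
  obtain p where p: "p \<in> effective_dom g" "\<And>x. x \<in> effective_dom g \<Longrightarrow>
    val g p + 1/2 * (norm (p - u))\<^sup>2 \<le> val g x + 1/2 * (norm (x - u))\<^sup>2"
    using Gamma0_prox_minimizer[OF g] by blast
  have "h p \<le> h x" for x
    using p h hinf by (cases "x \<in> effective_dom g") auto
  then have "is_arg_min h (\<lambda>x. True) p" by (auto simp: is_arg_min_def not_less)
  then have "is_arg_min h (\<lambda>x. True) (prox g u)"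
    unfolding prox_def arg_min_def h_def by (rule someI)
  then have min: "h (prox g u) \<le> h x" for x by (auto simp: is_arg_min_def not_less)
  show dom: "prox g u \<in> effective_dom g"
    using min[of p] h[OF p(1)] hinf[of "prox g u"] by force
  show "x \<in> effective_dom g \<Longrightarrow>
      val g (prox g u) + 1/2 * (norm (prox g u - u))\<^sup>2 \<le> val g x + 1/2 * (norm (x - u))\<^sup>2"
    using min[of x] h dom by simp
qed

text \<open>
  First-order optimality: \<open>u - prox g u\<close> is a subgradient of \<open>g\<close> at \<open>prox g u\<close>. Moving from
  the minimiser by a fraction \<open>r\<close> towards \<open>x\<close> gives the inequality up to an error of order
  \<open>r\<close>, which then tends to zero.
\<close>
lemma prox_variational_inequality:
  fixes u :: "'a::{real_inner, complete_space}"
  assumes g: "g \<in> Gamma0" and x: "x \<in> effective_dom g"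
  shows "inner (u - prox g u) (x - prox g u) \<le> val g x - val g (prox g u)"
proof -
  let ?p = "prox g u"
  have pD: "?p \<in> effective_dom g" by (rule prox_minimizes(1)[OF g])
  have key: "inner (u - ?p) (x - ?p) - (val g x - val g ?p) \<le> r / 2 * (norm (x - ?p))\<^sup>2"
    if r: "0 < r" "r < 1" for r
  proof -
    let ?y = "(1 - r) *\<^sub>R ?p + r *\<^sub>R x"
    have y: "?y \<in> effective_dom g"
      using Gamma0_convex_on_val[OF g] pD x r by (auto simp: convex_on_def convex_alt)
    have c: "val g ?y \<le> (1 - r) * val g ?p + r * val g x"
      using convex_onD[OF Gamma0_convex_on_val[OF g], of r ?p x] pD x r by simp
    have yu: "?y - u = (?p - u) + r *\<^sub>R (x - ?p)" by (simp add: algebra_simps)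
    have "(norm (?y - u))\<^sup>2 = (norm (?p - u))\<^sup>2 - 2 * r * inner (u - ?p) (x - ?p) + r\<^sup>2 * (norm (x - ?p))\<^sup>2"
      unfolding yu power2_norm_eq_inner by (simp add: algebra_simps inner_commute power2_eq_square)
    with prox_minimizes(2)[OF g y, of u] c
    have "r * (inner (u - ?p) (x - ?p) - (val g x - val g ?p)) \<le> r * (r / 2 * (norm (x - ?p))\<^sup>2)"
      by (simp add: algebra_simps power2_eq_square)
    then show ?thesis using r by simp
  qed
  have "((\<lambda>r. r / 2 * (norm (x - ?p))\<^sup>2) \<longlongrightarrow> 0 / 2 * (norm (x - ?p))\<^sup>2) (at_right 0)"
    by (intro tendsto_intros) simp
  moreover have "\<forall>\<^sub>F r in at_right 0. inner (u - ?p) (x - ?p) - (val g x - val g ?p) \<le> r / 2 * (norm (x - ?p))\<^sup>2"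
    using eventually_at_right_real[OF zero_less_one] by eventually_elim (rule key; simp)
  ultimately have "inner (u - ?p) (x - ?p) - (val g x - val g ?p) \<le> 0 / 2 * (norm (x - ?p))\<^sup>2"
    by (intro tendsto_lowerbound) auto
  then show ?thesis by simp
qed

text \<open>
  The one-step estimate. The variational inequalities of the two proximal steps, the
  second tested at \<open>y\<close> and the first at \<open>z'\<close>, add up to an estimate with the single error term
  \<open>2 * t * inner (V w - V w') (w - z')\<close>, which arises because the first step uses the operator
  at the old point \<open>w'\<close>. For \<open>4 * t * L \<le> 1\<close> this error is at most
  \<open>(norm (z - w))\<^sup>2 / 2 + (norm (z - w'))\<^sup>2 / 2 + (norm (z' - w))\<^sup>2 / 4\<close>. The first and third parts
  are paid by negative squares that this estimate contains, and the middle part is the quantity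
  carried over from the previous step, so the estimate telescopes.
\<close>
lemma optimistic_step:
  fixes V :: "'a::{real_inner, complete_space} \<Rightarrow> 'a"
  assumes G: "G \<in> Gamma0" and V: "L-lipschitz_on UNIV V" and t: "t > 0" "4 * (t * L) \<le> 1"
    and w: "w = prox (\<lambda>x. ereal t * G x) (z - t *\<^sub>R V w')"
    and z': "z' = prox (\<lambda>x. ereal t * G x) (z - t *\<^sub>R V w)"
    and y: "y \<in> effective_dom G"
  shows "(norm (z' - y))\<^sup>2 + 1/2 * (norm (z' - w))\<^sup>2 \<le>
    (norm (z - y))\<^sup>2 + 1/2 * (norm (z - w'))\<^sup>2 + 2 * t * (inner (V w) (y - w) + val G y - val G w)"
proof -
  let ?tG = "\<lambda>x. ereal t * G x"
  have tG: "?tG \<in> Gamma0" by (rule Gamma0_scale[OF G t(1)])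
  have dom: "effective_dom ?tG = effective_dom G" by (rule effective_dom_scale[OF t(1)])
  have z'D: "z' \<in> effective_dom ?tG" unfolding z' by (rule prox_minimizes(1)[OF tG])
  have 1: "inner (z - t *\<^sub>R V w - z') (y - z') \<le> t * val G y - t * val G z'"
    using prox_variational_inequality[OF tG y[folded dom], of "z - t *\<^sub>R V w"] by (simp flip: z')
  have 2: "inner (z - t *\<^sub>R V w' - w) (z' - w) \<le> t * val G z' - t * val G w"
    using prox_variational_inequality[OF tG z'D, of "z - t *\<^sub>R V w'"] by (simp flip: w)
  define a b where "a = norm (w - w')" and "b = norm (z' - w)"
  have "- inner (V w - V w') (z' - w) \<le> norm (V w - V w') * b"
    unfolding b_def using Cauchy_Schwarz_ineq2[of "V w - V w'" "z' - w"] by linarith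
  also have "\<dots> \<le> (L * a) * b"
    using lipschitz_onD[OF V, of w w'] by (intro mult_right_mono) (auto simp: a_def b_def dist_norm)
  finally have "2 * t * (- inner (V w - V w') (z' - w)) \<le> 2 * t * ((L * a) * b)"
    using t by (intro mult_left_mono) auto
  also have "\<dots> = (4 * (t * L)) * (a * b) / 2" by simp
  also have "\<dots> \<le> 1 * (a * b) / 2"
    using t(2) by (intro divide_right_mono mult_right_mono) (auto simp: a_def b_def)
  also have "\<dots> \<le> 1/4 * a\<^sup>2 + 1/4 * b\<^sup>2"
    using sum_squares_ge_zero[of "a - b" 0] by (simp add: power2_eq_square algebra_simps)
  finally have cross: "2 * t * (- inner (V w - V w') (z' - w)) \<le> 1/4 * a\<^sup>2 + 1/4 * b\<^sup>2" .
  have "a\<^sup>2 \<le> 2 * (norm (z - w))\<^sup>2 + 2 * (norm (z - w'))\<^sup>2"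
  proof -
    have "a \<le> norm (z - w) + norm (z - w')"
      unfolding a_def using norm_triangle_ineq4[of "z - w'" "z - w"] by simp
    then have "a\<^sup>2 \<le> (norm (z - w) + norm (z - w'))\<^sup>2"
      by (intro power_mono) (auto simp: a_def)
    also have "\<dots> \<le> 2 * (norm (z - w))\<^sup>2 + 2 * (norm (z - w'))\<^sup>2"
      using sum_squares_ge_zero[of "norm (z - w) - norm (z - w')" 0]
      by (simp add: power2_eq_square algebra_simps)
    finally show ?thesis .
  qed
  with cross have 3: "2 * t * (- inner (V w - V w') (z' - w)) \<le>
      1/2 * (norm (z - w))\<^sup>2 + 1/2 * (norm (z - w'))\<^sup>2 + 1/4 * b\<^sup>2"
    by argo
  have "(norm (z' - y))\<^sup>2 + (norm (z - w))\<^sup>2 + b\<^sup>2 - (norm (z - y))\<^sup>2 =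
     2 * inner (z - t *\<^sub>R V w - z') (y - z') + 2 * inner (z - t *\<^sub>R V w' - w) (z' - w)
     + 2 * t * (- inner (V w - V w') (z' - w)) + 2 * t * inner (V w) (y - w)"
    unfolding b_def power2_norm_eq_inner by (simp add: algebra_simps inner_commute)
  moreover have "b\<^sup>2 \<ge> 0" "(norm (z - w))\<^sup>2 \<ge> 0" by simp_all
  moreover have "2 * t * (inner (V w) (y - w) + val G y - val G w) =
      2 * t * inner (V w) (y - w) + 2 * (t * val G y) - 2 * (t * val G w)"
    by (simp add: algebra_simps)
  ultimately show ?thesis
    using 1 2 3 unfolding b_def[symmetric] by argo
qed

section \<open>Bifunctions, subgradients and normal cones\<close>

text \<open>The real counterpart of \<^const>\<open>bifun\<close>, meaningful when both points lie in the domain of \<open>g\<close>.\<close>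
definition rbifun :: "('a::real_inner \<Rightarrow> 'a) \<Rightarrow> ('a \<Rightarrow> ereal) \<Rightarrow> 'a \<Rightarrow> 'a \<Rightarrow> real" where
  "rbifun F g x y = inner (F y) (x - y) + val g x - val g y"

lemma bifun_eq_rbifun:
  assumes "g \<in> Gamma0" "x \<in> effective_dom g" "y \<in> effective_dom g"
  shows "bifun F g x y = ereal (rbifun F g x y)"
  unfolding bifun_def rbifun_def
  by (subst (1 2) Gamma0_val[OF assms(1)]) (use assms in auto)

lemma rbifun_antisym_le:
  assumes "monotone_op F"
  shows "rbifun F g y x \<le> - rbifun F g x y"
proof -
  have "0 \<le> inner (F x - F y) (x - y)" using assms by (auto simp: monotone_op_def)
  then show ?thesis unfolding rbifun_def by (simp add: algebra_simps)
qed

lemma subdiff_val: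
  assumes g: "g \<in> Gamma0" and p: "p \<in> subdiff g x"
  shows "x \<in> effective_dom g"
    and "y \<in> effective_dom g \<Longrightarrow> inner p (y - x) \<le> val g y - val g x"
proof -
  obtain x0 where "x0 \<in> effective_dom g" using g by (auto simp: Gamma0_def proper_fun_def)
  moreover have ineq: "g x + ereal (inner p (y - x)) \<le> g y" for y using p by (auto simp: subdiff_def)
  ultimately show xD: "x \<in> effective_dom g"
    using ineq[of x0] by (auto simp: effective_dom_def)
  assume yD: "y \<in> effective_dom g"
  have "ereal (val g x) + ereal (inner p (y - x)) \<le> ereal (val g y)"
    using ineq[of y] Gamma0_val[OF g xD] Gamma0_val[OF g yD] by simp
  then show "inner p (y - x) \<le> val g y - val g x" by simp
qed

lemma lower_sols_rbifun_nonneg: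
  assumes g: "g \<in> Gamma0" and y: "y \<in> lower_sols F g"
  shows "y \<in> effective_dom g"
    and "x \<in> effective_dom g \<Longrightarrow> 0 \<le> rbifun F g x y"
proof -
  obtain q where q: "q \<in> subdiff g y" "F y + q = 0"
    using y by (auto simp: lower_sols_def zer_def set_plus_def)
  then show "y \<in> effective_dom g" using subdiff_val(1)[OF g] by blast
  have "q = - F y" using q(2) by (simp add: eq_neg_iff_add_eq_0 add.commute)
  then show "x \<in> effective_dom g \<Longrightarrow> 0 \<le> rbifun F g x y"
    using subdiff_val(2)[OF g q(1)] unfolding rbifun_def by fastforce
qed

text \<open>
  A zero of \<open>F + subdiff g + normal_cone S\<close> carries a multiplier \<open>p\<close>. It controls the
  bifunction from below at all points of the domain, feasible or not; off \<open>S\<close> the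
  bifunction may be negative, but no more than \<open>p\<close> permits.
\<close>
lemma normal_cone_multiplier:
  assumes g: "g \<in> Gamma0" and y: "y \<in> zer (\<lambda>x. {F x} + subdiff g x + normal_cone S x)"
  obtains p where "y \<in> S" "y \<in> effective_dom g" "p \<in> normal_cone S y"
    "\<And>x. x \<in> effective_dom g \<Longrightarrow> - inner p (x - y) \<le> rbifun F g x y"
proof -
  obtain q p where qp: "q \<in> subdiff g y" "p \<in> normal_cone S y" "F y + q + p = 0"
    using y by (auto simp: zer_def set_plus_def)
  have "q = - F y - p" using qp(3) by (simp add: eq_neg_iff_add_eq_0 algebra_simps)
  then have "- inner p (x - y) \<le> rbifun F g x y" if "x \<in> effective_dom g" for x
    using subdiff_val(2)[OF g qp(1) that] unfolding rbifun_def by (simp add: inner_diff_left)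
  moreover have "y \<in> S" using qp(2) by (auto simp: normal_cone_def split: if_splits)
  ultimately show thesis using that qp(2) subdiff_val(1)[OF g qp(1)] by blast
qed

text \<open>
  A normal functional does not increase from \<open>y\<close> to any point \<open>s\<close> of \<open>S\<close>, so its growth from
  \<open>y\<close> to \<open>x\<close> is at most its growth from \<open>s\<close> to \<open>x\<close>. The infimum over \<open>s\<close> gives the distance.
\<close>
lemma normal_cone_inner_le_infdist:
  assumes p: "p \<in> normal_cone S y"
  shows "inner p (x - y) \<le> norm p * infdist x S"
proof -
  have y: "y \<in> S" and N: "\<And>s. s \<in> S \<Longrightarrow> inner p (s - y) \<le> 0"
    using p by (auto simp: normal_cone_def split: if_splits)
  have "inner p (x - y) \<le> norm p * dist x s" if "s \<in> S" for s
  proof -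
    have "inner p (x - y) = inner p (x - s) + inner p (s - y)" by (simp add: algebra_simps)
    also have "\<dots> \<le> norm p * norm (x - s)"
      using N[OF that] norm_cauchy_schwarz[of p "x - s"] by linarith
    finally show ?thesis by (simp add: dist_norm)
  qed
  note * = this
  show ?thesis
  proof (cases "p = 0")
    case False
    have "inner p (x - y) / norm p \<le> (INF s\<in>S. dist x s)"
      using * y False by (intro cINF_greatest) (auto simp: field_simps)
    then show ?thesis using y False by (auto simp: infdist_def field_simps)
  qed simp
qed

lemma support_fun_normal_cone:
  assumes p: "p \<in> normal_cone S y" and c: "c \<ge> 0"
  shows "support_fun (c *\<^sub>R p) S = ereal (c * inner p y)"
proof -
  have y: "y \<in> S" and N: "\<And>s. s \<in> S \<Longrightarrow> inner p (s - y) \<le> 0"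
    using p by (auto simp: normal_cone_def split: if_splits)
  have "inner p s \<le> inner p y" if "s \<in> S" for s using N[OF that] by (simp add: inner_diff_right)
  then show ?thesis
    unfolding support_fun_def using y c
    by (intro antisym SUP_least SUP_upper2[of y]) (auto intro: mult_left_mono)
qed

section \<open>Two estimates for sums\<close>

text \<open>
  Integral comparison: each summand is at most the increment of the antiderivative over the
  unit interval to its left.
\<close>
lemma sum_inverse_powr_le:
  fixes b \<delta> :: real
  assumes b: "b > 0" and d: "0 < \<delta>" "\<delta> < 1"
  shows "(\<Sum>k=1..K. 1 / (real k + b) powr \<delta>) \<le> (real K + b) powr (1 - \<delta>) / (1 - \<delta>)"
proof (induction K)
  case (Suc K)
  define x where "x = real K + b"
  have x: "x > 0" using b by (simp add: x_def)
  have "\<exists>s. x < s \<and> s < x + 1 \<and> (x + 1) powr (1 - \<delta>) - x powr (1 - \<delta>) = (x + 1 - x) * ((1 - \<delta>) * s powr (1 - \<delta> - 1))"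
    using x by (intro MVT2) (auto intro!: derivative_eq_intros)
  then obtain s where s: "x < s" "s < x + 1"
      "(x + 1) powr (1 - \<delta>) - x powr (1 - \<delta>) = (1 - \<delta>) * s powr (- \<delta>)"
    by auto
  have "(x + 1) powr (- \<delta>) \<le> s powr (- \<delta>)"
    using s x d by (intro powr_mono2') auto
  also have "s powr (- \<delta>) = ((x + 1) powr (1 - \<delta>) - x powr (1 - \<delta>)) / (1 - \<delta>)"
    using s(3) d by simp
  finally have "1 / (real (Suc K) + b) powr \<delta> \<le> ((x + 1) powr (1 - \<delta>) - x powr (1 - \<delta>)) / (1 - \<delta>)"
    by (simp add: x_def powr_minus_divide add_ac)
  with Suc.IH show ?case by (simp add: x_def diff_divide_distrib add_ac)
qed (use assms in simp)

text \<open>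
  Summation by parts. Weighting the decrements of a bounded nonnegative sequence by the
  nondecreasing factors \<open>1 / \<sigma> k\<close> costs only the last and largest factor. The induction needs the
  sharper right-hand side \<open>(M - E (Suc K)) / \<sigma> K\<close>.
\<close>
lemma sum_weighted_decrements_le:
  fixes E \<sigma> :: "nat \<Rightarrow> real"
  assumes pos: "\<And>k. k \<ge> 1 \<Longrightarrow> \<sigma> k > 0"
    and anti: "\<And>k. k \<ge> 1 \<Longrightarrow> \<sigma> (Suc k) \<le> \<sigma> k"
    and E: "\<And>k. k \<ge> 1 \<Longrightarrow> 0 \<le> E k" "\<And>k. k \<ge> 1 \<Longrightarrow> E k \<le> M"
    and K: "K \<ge> 1"
  shows "(\<Sum>k=1..K. (E k - E (Suc k)) / \<sigma> k) \<le> M / \<sigma> K"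
proof -
  have "(\<Sum>k=1..K. (E k - E (Suc k)) / \<sigma> k) \<le> (M - E (Suc K)) / \<sigma> K"
    using K
  proof (induction K rule: dec_induct)
    case base
    then show ?case using E(2)[of 1] pos[of 1] by (auto intro!: divide_right_mono)
  next
    case (step n)
    have "(M - E (Suc n)) / \<sigma> n \<le> (M - E (Suc n)) / \<sigma> (Suc n)"
      using E(2)[of "Suc n"] pos[of n] pos[of "Suc n"] anti[of n] step by (intro divide_left_mono) auto
    with step.IH have "(\<Sum>k=1..Suc n. (E k - E (Suc k)) / \<sigma> k) \<le>
        (M - E (Suc n)) / \<sigma> (Suc n) + (E (Suc n) - E (Suc (Suc n))) / \<sigma> (Suc n)" by simp
    then show ?case by (simp flip: add_divide_distrib)
  qed
  also have "\<dots> \<le> M / \<sigma> K" using E(1)[of "Suc K"] pos[OF K] by (intro divide_right_mono) auto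
  finally show ?thesis .
qed

section \<open>Runs of the optimistic extragradient method\<close>

text \<open>
  The parameters \<open>\<sigma>\<close> are positive and nonincreasing: the step size condition at index 1 then
  implies the one at every later index, and the weights \<open>1 / \<sigma> k\<close> of \<open>optimality_bound\<close> are
  nondecreasing.
\<close>
locale optimistic_extragradient_run =
  fixes F1 F2 :: "'a::{real_inner, complete_space} \<Rightarrow> 'a"
    and g1 g2 :: "'a \<Rightarrow> ereal"
    and L1 L2 t :: real
    and \<sigma> :: "nat \<Rightarrow> real"
    and z w :: "nat \<Rightarrow> 'a"
  assumes mono1: "monotone_op F1" and lip1: "L1-lipschitz_on UNIV F1"
    and mono2: "monotone_op F2" and lip2: "L2-lipschitz_on UNIV F2"
    and g1: "g1 \<in> Gamma0" and g2: "g2 \<in> Gamma0"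
    and dom_ne: "effective_dom g1 \<inter> effective_dom g2 \<noteq> {}"
    and sigma_pos: "\<And>k. k \<ge> 1 \<Longrightarrow> \<sigma> k > 0"
    and sigma_Suc: "\<And>k. k \<ge> 1 \<Longrightarrow> \<sigma> (Suc k) \<le> \<sigma> k"
    and t_pos: "0 < t" and t_le: "t * (4 * (L2 + \<sigma> 1 * L1)) \<le> 1"
    and run: "optimistic_extragradient F1 g1 F2 g2 \<sigma> (\<lambda>_. t) z w"
begin

abbreviation D :: "'a set" where "D \<equiv> effective_dom g1 \<inter> effective_dom g2"

definition V :: "nat \<Rightarrow> 'a \<Rightarrow> 'a" where "V k x = F2 x + \<sigma> k *\<^sub>R F1 x"
definition G :: "nat \<Rightarrow> 'a \<Rightarrow> ereal" where "G k x = g2 x + ereal (\<sigma> k) * g1 x"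

text \<open>
  The squared distance to \<open>y\<close> together with the quantity that \<open>optimistic_step\<close> carries over.
  At index 1 the second summand vanishes since \<open>w 0 = z 1\<close>.
\<close>
definition energy :: "'a \<Rightarrow> nat \<Rightarrow> real" where
  "energy y k = (norm (z k - y))\<^sup>2 + 1/2 * (norm (z k - w (k - 1)))\<^sup>2"

definition zbar :: "nat \<Rightarrow> 'a" where
  "zbar K = (1 / real K) *\<^sub>R (\<Sum>k=1..K. w k)"

lemma w_0: "w 0 = z 1"
  and w_prox: "k \<ge> 1 \<Longrightarrow> w k = prox (\<lambda>x. ereal t * G k x) (z k - t *\<^sub>R V k (w (k - 1)))"
  and z_prox: "k \<ge> 1 \<Longrightarrow> z (Suc k) = prox (\<lambda>x. ereal t * G k x) (z k - t *\<^sub>R V k (w k))"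
  using run by (auto simp: optimistic_extragradient_def Let_def V_def G_def)

lemma sigma_le_1: "k \<ge> 1 \<Longrightarrow> \<sigma> k \<le> \<sigma> 1"
  by (induction k rule: dec_induct) (use sigma_Suc in \<open>auto intro: order_trans\<close>)

lemma effective_dom_G:
  assumes "k \<ge> 1" shows "effective_dom (G k) = D"
proof -
  have "effective_dom (G k) = effective_dom g2 \<inter> effective_dom (\<lambda>x. ereal (\<sigma> k) * g1 x)"
    unfolding G_def by (rule effective_dom_add[OF g2 Gamma0_scale[OF g1 sigma_pos[OF assms]]])
  then show ?thesis by (auto simp: effective_dom_scale[OF sigma_pos[OF assms]])
qed

lemma Gamma0_G:
  assumes "k \<ge> 1" shows "G k \<in> Gamma0"
  unfolding G_def
  using dom_ne effective_dom_scale[OF sigma_pos[OF assms], of g1]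
  by (intro Gamma0_add[OF g2 Gamma0_scale[OF g1 sigma_pos[OF assms]]]) auto

lemma val_G:
  assumes "x \<in> D"
  shows "val (G k) x = val g2 x + \<sigma> k * val g1 x"
proof -
  have "G k x = ereal (val g2 x) + ereal (\<sigma> k) * ereal (val g1 x)"
    unfolding G_def using Gamma0_val[OF g1, of x] Gamma0_val[OF g2, of x] assms by auto
  then show ?thesis by simp
qed

lemma lipschitz_V:
  assumes "k \<ge> 1" shows "(L2 + \<sigma> k * L1)-lipschitz_on UNIV (V k)"
  unfolding V_def using lipschitz_on_cmult_nonneg[OF lip1, of "\<sigma> k"] lip2 sigma_pos[OF assms]
  by (intro lipschitz_on_add) auto

lemma step_size:
  assumes "k \<ge> 1" shows "4 * (t * (L2 + \<sigma> k * L1)) \<le> 1"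
proof -
  have "\<sigma> k * L1 \<le> \<sigma> 1 * L1"
    using sigma_le_1[OF assms] lipschitz_on_nonneg[OF lip1] by (rule mult_right_mono)
  then have "t * (4 * (L2 + \<sigma> k * L1)) \<le> t * (4 * (L2 + \<sigma> 1 * L1))"
    using t_pos by (intro mult_left_mono) auto
  with t_le show ?thesis by (simp add: algebra_simps)
qed

lemma w_in_D: "k \<ge> 1 \<Longrightarrow> w k \<in> D"
  and z_in_D: "k \<ge> 1 \<Longrightarrow> z (Suc k) \<in> D"
proof -
  assume k: "k \<ge> 1"
  have "(\<lambda>x. ereal t * G k x) \<in> Gamma0" by (rule Gamma0_scale[OF Gamma0_G[OF k] t_pos])
  note prox_minimizes(1)[OF this]
  moreover have "effective_dom (\<lambda>x. ereal t * G k x) = D"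
    using effective_dom_scale[OF t_pos, of "G k"] effective_dom_G[OF k] by simp
  ultimately show "w k \<in> D" "z (Suc k) \<in> D" using w_prox[OF k] z_prox[OF k] by auto
qed

lemma energy_nonneg: "0 \<le> energy y k"
  by (simp add: energy_def)

lemma energy_1: "energy y 1 = (norm (z 1 - y))\<^sup>2"
  by (simp add: energy_def w_0)

text \<open>
  Here the bifunctions have the iterate in their second argument, as the function \<^const>\<open>phi\<close>
  requires; exchanging the arguments by monotonicity gives \<open>energy_descent\<close>.
\<close>
lemma energy_step:
  assumes k: "k \<ge> 1" and y: "y \<in> D"
  shows "energy y (Suc k) \<le> energy y k + 2 * t * (rbifun F2 g2 y (w k) + \<sigma> k * rbifun F1 g1 y (w k))"
proof -
  have "inner (V k (w k)) (y - w k) + val (G k) y - val (G k) (w k)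
      = rbifun F2 g2 y (w k) + \<sigma> k * rbifun F1 g1 y (w k)"
    using val_G[OF y, of k] val_G[OF w_in_D[OF k], of k]
    by (simp add: rbifun_def V_def algebra_simps)
  then show ?thesis
    using optimistic_step[OF Gamma0_G[OF k] lipschitz_V[OF k] t_pos step_size[OF k] w_prox[OF k] z_prox[OF k], of y]
      y effective_dom_G[OF k]
    by (simp add: energy_def)
qed

lemma energy_descent:
  assumes k: "k \<ge> 1" and y: "y \<in> D"
  shows "2 * t * (rbifun F2 g2 (w k) y + \<sigma> k * rbifun F1 g1 (w k) y) \<le> energy y k - energy y (Suc k)"
proof -
  have "\<sigma> k * rbifun F1 g1 y (w k) \<le> \<sigma> k * - rbifun F1 g1 (w k) y"
    using rbifun_antisym_le[OF mono1] sigma_pos[OF k] by (intro mult_left_mono) auto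
  then have "rbifun F2 g2 y (w k) + \<sigma> k * rbifun F1 g1 y (w k)
      \<le> - (rbifun F2 g2 (w k) y + \<sigma> k * rbifun F1 g1 (w k) y)"
    using rbifun_antisym_le[OF mono2, of g2 y "w k"] by simp
  then have "2 * t * (rbifun F2 g2 y (w k) + \<sigma> k * rbifun F1 g1 y (w k))
      \<le> 2 * t * - (rbifun F2 g2 (w k) y + \<sigma> k * rbifun F1 g1 (w k) y)"
    using t_pos by (intro mult_left_mono) auto
  with energy_step[OF k y] show ?thesis by (simp add: algebra_simps)
qed

lemma zbar_average:
  assumes g: "g \<in> Gamma0" and K: "K \<ge> 1" and W: "\<And>k. k \<ge> 1 \<Longrightarrow> w k \<in> effective_dom g"
  shows "zbar K \<in> effective_dom g"
    and "rbifun F g (zbar K) y \<le> (1 / real K) * (\<Sum>k=1..K. rbifun F g (w k) y)"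
proof -
  have zb: "zbar K = (\<Sum>k=1..K. (1 / real K) *\<^sub>R w k)" by (simp add: zbar_def scaleR_sum_right)
  note conv = Gamma0_convex_on_val[OF g]
  have "(\<Sum>k=1..K. (1 / real K) *\<^sub>R w k) \<in> effective_dom g"
    using conv K W by (intro convex_sum) (auto simp: convex_on_def)
  then show "zbar K \<in> effective_dom g" by (simp add: zb)
  have "val g (zbar K) \<le> (\<Sum>k=1..K. (1 / real K) * val g (w k))"
    unfolding zb using K W by (intro convex_on_sum[OF _ _ conv]) auto
  moreover have "inner (F y) (zbar K - y) = (1 / real K) * (\<Sum>k=1..K. inner (F y) (w k - y))"
    using K by (simp add: zbar_def inner_diff_right inner_sum_right sum_subtractf diff_divide_distrib)
  ultimately show "rbifun F g (zbar K) y \<le> (1 / real K) * (\<Sum>k=1..K. rbifun F g (w k) y)"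
    using K by (simp add: rbifun_def sum.distrib sum_subtractf add_divide_distrib diff_divide_distrib
        flip: sum_divide_distrib)
qed

lemma zbar_in_D:
  assumes "K \<ge> 1" shows "zbar K \<in> D"
  using zbar_average(1)[OF g1 assms] zbar_average(1)[OF g2 assms] w_in_D by auto

lemma sum_energy_le:
  assumes y: "y \<in> D"
  shows "(\<Sum>k=1..K. rbifun F2 g2 (w k) y + \<sigma> k * rbifun F1 g1 (w k) y) \<le> (norm (z 1 - y))\<^sup>2 / (2 * t)"
proof -
  have "2 * t * (\<Sum>k=1..K. rbifun F2 g2 (w k) y + \<sigma> k * rbifun F1 g1 (w k) y)
      \<le> energy y 1 - energy y (Suc K)"
  proof (induction K)
    case (Suc K)
    then show ?case using energy_descent[of "Suc K" y] y by (simp add: distrib_left)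
  qed simp
  then have "2 * t * (\<Sum>k=1..K. rbifun F2 g2 (w k) y + \<sigma> k * rbifun F1 g1 (w k) y) \<le> (norm (z 1 - y))\<^sup>2"
    using energy_nonneg[of y "Suc K"] energy_1[of y] by linarith
  then show ?thesis using t_pos by (simp add: field_simps)
qed

text \<open>
  Moving the upper-level part of the telescoped inequality to the right treats it as a
  perturbation of size \<open>\<sigma> k\<close>.
\<close>
lemma feasibility_bound:
  assumes K: "K \<ge> 1" and y: "y \<in> D" and C: "\<And>k. k \<ge> 1 \<Longrightarrow> - rbifun F1 g1 (w k) y \<le> C"
  shows "rbifun F2 g2 (zbar K) y \<le> (norm (z 1 - y))\<^sup>2 / (2 * real K * t) + C * (\<Sum>k=1..K. \<sigma> k) / real K"
proof -
  have "(\<Sum>k=1..K. rbifun F2 g2 (w k) y)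
      \<le> (\<Sum>k=1..K. (rbifun F2 g2 (w k) y + \<sigma> k * rbifun F1 g1 (w k) y) + C * \<sigma> k)"
  proof (rule sum_mono)
    fix k assume "k \<in> {1..K}"
    then have k: "k \<ge> 1" by simp
    have "\<sigma> k * - rbifun F1 g1 (w k) y \<le> \<sigma> k * C"
      using C[OF k] sigma_pos[OF k] by (intro mult_left_mono) auto
    then show "rbifun F2 g2 (w k) y \<le> (rbifun F2 g2 (w k) y + \<sigma> k * rbifun F1 g1 (w k) y) + C * \<sigma> k"
      by (simp add: mult.commute)
  qed
  also have "\<dots> = (\<Sum>k=1..K. rbifun F2 g2 (w k) y + \<sigma> k * rbifun F1 g1 (w k) y) + C * (\<Sum>k=1..K. \<sigma> k)"
    by (simp add: sum.distrib sum_distrib_left)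
  also have "\<dots> \<le> (norm (z 1 - y))\<^sup>2 / (2 * t) + C * (\<Sum>k=1..K. \<sigma> k)"
    using sum_energy_le[OF y] by simp
  finally have "(1 / real K) * (\<Sum>k=1..K. rbifun F2 g2 (w k) y)
     \<le> (1 / real K) * ((norm (z 1 - y))\<^sup>2 / (2 * t) + C * (\<Sum>k=1..K. \<sigma> k))"
    by (intro mult_left_mono) auto
  with zbar_average(2)[OF g2 K, of F2 y] w_in_D
  show ?thesis by (fastforce simp: algebra_simps add_divide_distrib)
qed

text \<open>
  At a lower-level solution the lower-level part of \<open>energy_descent\<close> is nonnegative and can be
  dropped. Dividing by \<open>\<sigma> k\<close> isolates the upper-level part, and summation by parts replaces
  telescoping; this is why a bound on the energy at all indices is needed, not just at the
  first.
\<close>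
lemma optimality_bound:
  assumes K: "K \<ge> 1" and y: "y \<in> D" "y \<in> lower_sols F2 g2" and M: "\<And>k. k \<ge> 1 \<Longrightarrow> energy y k \<le> M"
  shows "rbifun F1 g1 (zbar K) y \<le> M / (2 * t * real K * \<sigma> K)"
proof -
  have "(\<Sum>k=1..K. rbifun F1 g1 (w k) y) \<le> (\<Sum>k=1..K. 1 / (2 * t) * ((energy y k - energy y (Suc k)) / \<sigma> k))"
  proof (rule sum_mono)
    fix k assume "k \<in> {1..K}"
    then have k: "k \<ge> 1" by simp
    have "0 \<le> 2 * t * rbifun F2 g2 (w k) y"
      using lower_sols_rbifun_nonneg(2)[OF g2 y(2)] w_in_D[OF k] t_pos by simp
    then have "2 * t * \<sigma> k * rbifun F1 g1 (w k) y \<le> energy y k - energy y (Suc k)"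
      using energy_descent[OF k y(1)] by (simp add: algebra_simps)
    then show "rbifun F1 g1 (w k) y \<le> 1 / (2 * t) * ((energy y k - energy y (Suc k)) / \<sigma> k)"
      using t_pos sigma_pos[OF k] by (simp add: field_simps)
  qed
  also have "\<dots> = 1 / (2 * t) * (\<Sum>k=1..K. (energy y k - energy y (Suc k)) / \<sigma> k)"
    by (simp add: sum_distrib_left)
  also have "\<dots> \<le> 1 / (2 * t) * (M / \<sigma> K)"
    using t_pos by (intro mult_left_mono sum_weighted_decrements_le sigma_pos sigma_Suc energy_nonneg M K) auto
  finally have "(1 / real K) * (\<Sum>k=1..K. rbifun F1 g1 (w k) y) \<le> (1 / real K) * (1 / (2 * t) * (M / \<sigma> K))"
    by (intro mult_left_mono) auto
  with zbar_average(2)[OF g1 K, of F1 y] w_in_D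
  show ?thesis by (fastforce simp: mult_ac)
qed

lemma bounded_iterates_of_energy:
  assumes "\<And>k. k \<ge> 1 \<Longrightarrow> energy y k \<le> M"
  shows "\<exists>R\<ge>0. \<forall>k. norm (w k) \<le> R \<and> norm (z (Suc k)) \<le> R"
proof -
  have M: "M \<ge> 0" using assms[of 1] energy_nonneg[of y 1] by linarith
  have z: "norm (z (Suc k) - y) \<le> sqrt M" "norm (z (Suc k) - w k) \<le> sqrt (2 * M)" for k
  proof -
    have e: "(norm (z (Suc k) - y))\<^sup>2 + 1/2 * (norm (z (Suc k) - w k))\<^sup>2 \<le> M"
      using assms[of "Suc k"] by (simp add: energy_def)
    have "0 \<le> (norm (z (Suc k) - y))\<^sup>2" "0 \<le> (norm (z (Suc k) - w k))\<^sup>2" by simp_all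
    with e have "(norm (z (Suc k) - y))\<^sup>2 \<le> M" "(norm (z (Suc k) - w k))\<^sup>2 \<le> 2 * M" by argo+
    then show "norm (z (Suc k) - y) \<le> sqrt M" "norm (z (Suc k) - w k) \<le> sqrt (2 * M)"
      by (auto intro: real_le_rsqrt)
  qed
  have "norm (w k) \<le> norm y + sqrt M + sqrt (2 * M) \<and> norm (z (Suc k)) \<le> norm y + sqrt M + sqrt (2 * M)" for k
    using z[of k] norm_triangle_sub[of "z (Suc k)" y] norm_triangle_sub[of "w k" "z (Suc k)"]
      norm_minus_commute[of "w k" "z (Suc k)"] norm_ge_zero[of "z (Suc k) - w k"] by linarith
  moreover have "0 \<le> norm y + sqrt M + sqrt (2 * M)" using M by simp
  ultimately show ?thesis by blast
qed

lemma energy_le_of_bounded: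
  assumes R: "\<And>k. norm (w k) \<le> R" "\<And>k. norm (z (Suc k)) \<le> R" and y: "norm y \<le> r" and k: "k \<ge> 1"
  shows "energy y k \<le> (R + r)\<^sup>2 + 1/2 * (2 * R)\<^sup>2"
proof -
  obtain j where j: "k = Suc j" using k by (cases k) auto
  have "norm (z k - y) \<le> R + r" "norm (z k - w (k - 1)) \<le> 2 * R"
    using norm_triangle_ineq4[of "z k" y] norm_triangle_ineq4[of "z k" "w j"] R(1)[of j] R(2)[of j] y j by auto
  then show ?thesis unfolding energy_def by (intro add_mono mult_left_mono power_mono) auto
qed

lemma bounded_iterates_of_bounded_dom:
  assumes "bounded D"
  shows "\<exists>R\<ge>0. \<forall>k. norm (w k) \<le> R \<and> norm (z (Suc k)) \<le> R"
proof -
  obtain R where R: "R > 0" "\<And>x. x \<in> D \<Longrightarrow> norm x \<le> R" using assms unfolding bounded_pos by blast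
  have "norm (w k) \<le> max R (norm (z 1)) \<and> norm (z (Suc k)) \<le> max R (norm (z 1))" for k
  proof (cases k)
    case 0
    then show ?thesis using w_0 by simp
  next
    case (Suc j)
    then show ?thesis using R(2) w_in_D[of k] z_in_D[of k] by (simp add: le_max_iff_disj)
  qed
  then show ?thesis using R(1) by (intro exI[of _ "max R (norm (z 1))"]) auto
qed

text \<open>
  The energy relative to a solution \<open>y\<close> need not decrease, because the iterates may be
  infeasible. With the multiplier \<open>p\<close> in place of \<open>F1\<close> and \<open>g1\<close>, the bound on its increase from
  \<open>energy_step\<close> is, up to the factor \<open>2 * t\<close>,
  \<open>rbifun F2 g2 y (w k) + inner (w k) (\<sigma> k *\<^sub>R p) - inner (\<sigma> k *\<^sub>R p) y\<close>. Its first two terms are one of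
  the values over which \<^const>\<open>phi\<close> takes the supremum, and the subtracted one is the support
  function, whose supremum is attained at \<open>y\<close>.
\<close>
lemma energy_increment_le_phi:
  assumes k: "k \<ge> 1" and y: "y \<in> D" and p: "p \<in> normal_cone S y"
    and mult: "\<And>x. x \<in> effective_dom g1 \<Longrightarrow> - inner p (x - y) \<le> rbifun F1 g1 x y"
  shows "ereal (rbifun F2 g2 y (w k) + \<sigma> k * rbifun F1 g1 y (w k))
     \<le> (SUP x\<in>S. phi F2 g2 x (\<sigma> k *\<^sub>R p)) - support_fun (\<sigma> k *\<^sub>R p) S"
proof -
  have yS: "y \<in> S" using p by (auto simp: normal_cone_def split: if_splits)
  have "rbifun F1 g1 y (w k) \<le> inner p (w k - y)"
    using rbifun_antisym_le[OF mono1, of g1 y "w k"] mult[of "w k"] w_in_D[OF k] by simp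
  then have "\<sigma> k * rbifun F1 g1 y (w k) \<le> \<sigma> k * inner p (w k - y)"
    using sigma_pos[OF k] by (intro mult_left_mono) auto
  then have "ereal (rbifun F2 g2 y (w k) + \<sigma> k * rbifun F1 g1 y (w k))
      \<le> ereal (rbifun F2 g2 y (w k) + inner (w k) (\<sigma> k *\<^sub>R p)) - ereal (\<sigma> k * inner p y)"
    by (simp add: inner_diff_right right_diff_distrib inner_commute)
  also have "ereal (rbifun F2 g2 y (w k) + inner (w k) (\<sigma> k *\<^sub>R p)) \<le> phi F2 g2 y (\<sigma> k *\<^sub>R p)"
    unfolding phi_def using bifun_eq_rbifun[OF g2, of y "w k" F2] w_in_D[OF k] y
    by (intro SUP_upper2[of "w k"]) auto
  also have "\<dots> \<le> (SUP x\<in>S. phi F2 g2 x (\<sigma> k *\<^sub>R p))" using yS by (rule SUP_upper)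
  finally show ?thesis
    using support_fun_normal_cone[OF p, of "\<sigma> k"] sigma_pos[OF k] by (auto intro: ereal_minus_mono)
qed

text \<open>
  Nonnegativity makes the infinite sum of the summability condition an upper bound for its
  partial sums.
\<close>
lemma phi_excess_nonneg:
  assumes g: "y \<in> effective_dom g2" and p: "p \<in> normal_cone S y" and c: "c \<ge> 0"
  shows "0 \<le> (SUP x\<in>S. phi F2 g2 x (c *\<^sub>R p)) - support_fun (c *\<^sub>R p) S"
proof -
  have yS: "y \<in> S" using p by (auto simp: normal_cone_def split: if_splits)
  have "ereal (c * inner p y) \<le> phi F2 g2 y (c *\<^sub>R p)"
    unfolding phi_def using bifun_eq_rbifun[OF g2 g g, of F2] g
    by (intro SUP_upper2[of y]) (auto simp: rbifun_def inner_commute)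
  also have "\<dots> \<le> (SUP x\<in>S. phi F2 g2 x (c *\<^sub>R p))" using yS by (rule SUP_upper)
  finally show ?thesis
    using support_fun_normal_cone[OF p c] by (simp add: ereal_le_minus)
qed

lemma bounded_iterates_of_summable:
  assumes y: "y \<in> D" and p: "p \<in> normal_cone S y"
    and mult: "\<And>x. x \<in> effective_dom g1 \<Longrightarrow> - inner p (x - y) \<le> rbifun F1 g1 x y"
    and summ: "(\<Sum>k. ereal t * ((SUP x\<in>S. phi F2 g2 x (\<sigma> (Suc k) *\<^sub>R p))
        - support_fun (\<sigma> (Suc k) *\<^sub>R p) S)) < \<infinity>"
  shows "\<exists>R\<ge>0. \<forall>k. norm (w k) \<le> R \<and> norm (z (Suc k)) \<le> R"
proof -
  define e where "e k = ereal t * ((SUP x\<in>S. phi F2 g2 x (\<sigma> (Suc k) *\<^sub>R p)) - support_fun (\<sigma> (Suc k) *\<^sub>R p) S)" for k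
  define c where "c k = t * (rbifun F2 g2 y (w (Suc k)) + \<sigma> (Suc k) * rbifun F1 g1 y (w (Suc k)))" for k
  have e_nonneg: "0 \<le> e k" for k
    unfolding e_def using phi_excess_nonneg[OF _ p, of "\<sigma> (Suc k)"] y sigma_pos[of "Suc k"] t_pos
    by (intro ereal_0_le_mult) auto
  have ce: "ereal (c k) \<le> e k" for k
  proof -
    have "ereal t * ereal (rbifun F2 g2 y (w (Suc k)) + \<sigma> (Suc k) * rbifun F1 g1 y (w (Suc k))) \<le> e k"
      unfolding e_def using energy_increment_le_phi[OF _ y p mult, of "Suc k"] t_pos
      by (intro ereal_mult_left_mono) auto
    then show ?thesis by (simp add: c_def)
  qed
  have "suminf e < \<infinity>" using summ by (simp add: e_def[abs_def])
  moreover have "0 \<le> suminf e" using e_nonneg by (rule suminf_0_le)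
  ultimately obtain M where M: "suminf e = ereal M" by (cases "suminf e") auto
  have c_sum: "(\<Sum>k<n. c k) \<le> M" for n
  proof -
    have "ereal (\<Sum>k<n. c k) = (\<Sum>k<n. ereal (c k))" by simp
    also have "\<dots> \<le> (\<Sum>k<n. e k)" by (intro sum_mono ce)
    also have "\<dots> \<le> suminf e" using e_nonneg by (rule suminf_upper)
    finally show ?thesis using M by simp
  qed
  have en: "energy y (Suc n) \<le> energy y 1 + 2 * (\<Sum>k<n. c k)" for n
  proof (induction n)
    case (Suc n)
    then show ?case using energy_step[of "Suc n" y] y by (simp add: c_def algebra_simps)
  qed simp
  have "energy y k \<le> energy y 1 + 2 * M" if k: "k \<ge> 1" for k
    using en[of "k - 1"] c_sum[of "k - 1"] k by simp
  then show ?thesis by (rule bounded_iterates_of_energy)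
qed

end

section \<open>Convergence rates\<close>

theorem corollary3p2:
  fixes F1 F2 :: "'a::{real_inner, polish_space} \<Rightarrow> 'a"
    and g1 g2 :: "'a \<Rightarrow> ereal"
    and L1 L2 a b \<delta> t :: real
    and \<sigma> :: "nat \<Rightarrow> real"
    and S1 S2 U1 U2 :: "'a set"
    and z w zbar :: "nat \<Rightarrow> 'a"
  assumes "monotone_op F1" and "L1-lipschitz_on UNIV F1"
    and "monotone_op F2" and "L2-lipschitz_on UNIV F2"
    and "g1 \<in> Gamma0" and "g2 \<in> Gamma0"
    and "effective_dom g1 \<inter> effective_dom g2 \<noteq> {}"
    and S2: "S2 = lower_sols F2 g2" and "S2 \<noteq> {}"
    and S1: "S1 = hierarchical_sols F1 g1 F2 g2"
    and "S1 = zer (\<lambda>x. {F1 x} + subdiff g1 x + normal_cone S2 x)" and "S1 \<noteq> {}"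
    and "closed (effective_dom g1 \<inter> effective_dom g2)"
    and "\<And>A B. compact A \<Longrightarrow> compact B \<Longrightarrow>
           A \<subseteq> effective_dom g1 \<inter> effective_dom g2 \<Longrightarrow>
           B \<subseteq> effective_dom g1 \<inter> effective_dom g2 \<Longrightarrow>
           (SUP (x, y)\<in>A \<times> B. \<bar>g1 x - g1 y\<bar>) < \<infinity>"
    and "a > 0" and "b > 0" and "0 < \<delta>" and "\<delta> < 1"
    and \<sigma>: "\<And>k. \<sigma> k = a / (real k + b) powr \<delta>"
    and "0 < t" and "t * (4 * (L2 + \<sigma> 1 * L1)) \<le> 1"
    and "(\<forall>p \<in> op_range (normal_cone S2).
            (\<Sum>k. ereal t * ((SUP x\<in>S2. phi F2 g2 x (\<sigma> (Suc k) *\<^sub>R p))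
                              - support_fun (\<sigma> (Suc k) *\<^sub>R p) S2)) < \<infinity>)
         \<or> compact (effective_dom g1 \<inter> effective_dom g2)"
    and "optimistic_extragradient F1 g1 F2 g2 \<sigma> (\<lambda>_. t) z w"
    and zbar: "\<And>K. zbar K = (1 / real K) *\<^sub>R (\<Sum>k=1..K. w k)"
    and "U2 \<subseteq> effective_dom g1 \<inter> effective_dom g2" and "U2 \<noteq> {}" and "compact U2"
    and "U1 \<subseteq> effective_dom g1 \<inter> effective_dom g2" and "compact U1"
    and "U1 \<inter> S1 \<noteq> {}"
  shows "\<exists>C2 C1 B1 :: real. C2 > 0 \<and> C1 > 0 \<and> B1 > 0 \<and>
    (\<forall>K\<ge>1.
       gap F2 g2 U2 (zbar K)
         \<le> ereal ((SUP x\<in>U2. (norm (z 1 - x))\<^sup>2) / (2 * real K * t)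
                   + a * C2 / ((1 - \<delta>) * (real K + b) powr \<delta>)) \<and>
       gap F1 g1 (U1 \<inter> S2) (zbar K)
         \<le> ereal (C1 / (a * (real K + b) powr (1 - \<delta>)))) \<and>
    (\<forall>\<alpha> \<rho>. weakly_sharp F2 g2 \<alpha> \<rho> \<longrightarrow> U2 \<inter> S2 \<noteq> {} \<longrightarrow>
       (\<forall>K\<ge>1.
          ereal (- B1 * ((SUP x\<in>U2. (norm (z 1 - x))\<^sup>2) / (2 * real K * t * (\<alpha> / \<rho>))
                          + a * C2 / ((\<alpha> / \<rho>) * (1 - \<delta>) * (real K + b) powr \<delta>)) powr (1 / \<rho>))
            \<le> gap F1 g1 (U1 \<inter> S2) (zbar K)))"
proof -
  note mono1 = assms(1) and lip1 = assms(2) and mono2 = assms(3) and lip2 = assms(4)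
    and g1 = assms(5) and g2 = assms(6) and dom_ne = assms(7)
    and g1_oscillation = assms(14) and summable_or_compact = assms(22)
    and S1_zer = \<open>S1 = zer (\<lambda>x. {F1 x} + subdiff g1 x + normal_cone S2 x)\<close>
  have \<sigma>_pos: "\<sigma> k > 0" for k
    unfolding \<sigma> using \<open>a > 0\<close> \<open>b > 0\<close> by (intro divide_pos_pos) auto
  have \<sigma>_Suc: "\<sigma> (Suc k) \<le> \<sigma> k" for k
    unfolding \<sigma> using \<open>a > 0\<close> \<open>b > 0\<close> \<open>0 < \<delta>\<close>
    by (intro divide_left_mono powr_mono2 mult_pos_pos) auto
  interpret run: optimistic_extragradient_run F1 F2 g1 g2 L1 L2 t \<sigma> z w
    by (intro optimistic_extragradient_run.intro mono1 mono2 lip1 lip2 g1 g2 dom_ne \<sigma>_pos \<sigma>_Suc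
        \<open>0 < t\<close> \<open>t * (4 * (L2 + \<sigma> 1 * L1)) \<le> 1\<close>
        \<open>optimistic_extragradient F1 g1 F2 g2 \<sigma> (\<lambda>_. t) z w\<close>)
  have zbar_eq: "zbar = run.zbar" by (rule ext) (simp add: zbar run.zbar_def)
  obtain y where y: "y \<in> U1" "y \<in> S1" using \<open>U1 \<inter> S1 \<noteq> {}\<close> by blast
  then obtain p where p: "y \<in> S2" "y \<in> effective_dom g1" "p \<in> normal_cone S2 y"
    and mult: "\<And>x. x \<in> effective_dom g1 \<Longrightarrow> - inner p (x - y) \<le> rbifun F1 g1 x y"
    using normal_cone_multiplier[OF g1, of y F1 S2] S1_zer by metis
  have yD: "y \<in> run.D" using p \<open>U1 \<subseteq> run.D\<close> y by auto
  \<comment> \<open>The two alternative conditions enter through the boundedness of the iterates.\<close>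
  have "\<exists>r\<ge>0. \<forall>k. norm (w k) \<le> r \<and> norm (z (Suc k)) \<le> r"
    using summable_or_compact
  proof
    assume "\<forall>p \<in> op_range (normal_cone S2).
            (\<Sum>k. ereal t * ((SUP x\<in>S2. phi F2 g2 x (\<sigma> (Suc k) *\<^sub>R p))
                              - support_fun (\<sigma> (Suc k) *\<^sub>R p) S2)) < \<infinity>"
    moreover have "p \<in> op_range (normal_cone S2)" using p(3) by (auto simp: op_range_def)
    ultimately show ?thesis
      by (intro run.bounded_iterates_of_summable[OF yD p(3) mult]) auto
  qed (intro run.bounded_iterates_of_bounded_dom compact_imp_bounded)
  then obtain r where r: "r \<ge> 0" "\<And>k. norm (w k) \<le> r" "\<And>k. norm (z (Suc k)) \<le> r" by blast
  obtain u1 where u1: "\<And>x. x \<in> U1 \<Longrightarrow> norm x \<le> u1"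
    using compact_imp_bounded[OF \<open>compact U1\<close>] unfolding bounded_iff by blast
  obtain u2 where u2: "\<And>x. x \<in> U2 \<Longrightarrow> norm x \<le> u2"
    using compact_imp_bounded[OF \<open>compact U2\<close>] unfolding bounded_iff by blast

  \<comment> \<open>
    On \<open>U2\<close> the function \<open>g1\<close> is bounded above because its oscillation against \<open>x0\<close> is finite;
    along the bounded iterates it is bounded below by its linear minorant.
  \<close>
  obtain x0 where x0: "x0 \<in> U2" using \<open>U2 \<noteq> {}\<close> by blast
  have "(SUP (x, y)\<in>U2 \<times> {x0}. \<bar>g1 x - g1 y\<bar>) < \<infinity>"
    using g1_oscillation[OF \<open>compact U2\<close> compact_sing[of x0] \<open>U2 \<subseteq> run.D\<close>] x0 \<open>U2 \<subseteq> run.D\<close> by auto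
  then obtain m where m: "(SUP (x, y)\<in>U2 \<times> {x0}. \<bar>g1 x - g1 y\<bar>) \<le> ereal m"
    by (metis ereal_dense2 less_imp_le)
  have g1_U2: "val g1 x \<le> val g1 x0 + m" if x: "x \<in> U2" for x
  proof -
    have "\<bar>g1 x - g1 x0\<bar> \<le> (SUP (x, y)\<in>U2 \<times> {x0}. \<bar>g1 x - g1 y\<bar>)"
      using x by (intro SUP_upper2[of "(x, x0)"]) auto
    also note m
    also have "g1 x - g1 x0 = ereal (val g1 x - val g1 x0)"
      using Gamma0_val[OF g1, of x] Gamma0_val[OF g1, of x0] x x0 \<open>U2 \<subseteq> run.D\<close>
      by (metis IntD1 ereal_minus(1) subsetD)
    finally show ?thesis by simp
  qed
  obtain A B where AB: "B \<ge> 0" "\<And>x. x \<in> effective_dom g1 \<Longrightarrow> A - B * norm x \<le> val g1 x"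
    using Gamma0_linear_lower_bound[OF g1] by blast
  \<comment> \<open>The maxima with 1 in \<open>C\<close> and \<open>M\<close> make the final constants positive.\<close>
  define C where "C = max 1 ((norm (F1 0) + L1 * u2) * (u2 + r) + (val g1 x0 + m) - (A - B * r))"
  have L1: "L1 \<ge> 0" using lip1 by (rule lipschitz_on_nonneg)
  have C: "- rbifun F1 g1 (w k) x \<le> C" if x: "x \<in> U2" and k: "k \<ge> 1" for x k
  proof -
    have "norm (F1 x) \<le> norm (F1 0) + L1 * norm x"
      using lipschitz_onD[OF lip1, of x 0] norm_triangle_sub[of "F1 x" "F1 0"] by (simp add: dist_norm)
    also have "\<dots> \<le> norm (F1 0) + L1 * u2" using u2[OF x] L1 by (simp add: mult_left_mono)
    finally have F: "norm (F1 x) \<le> norm (F1 0) + L1 * u2" .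
    have "- inner (F1 x) (w k - x) \<le> norm (F1 x) * norm (w k - x)"
      using Cauchy_Schwarz_ineq2[of "F1 x" "w k - x"] by linarith
    also have "\<dots> \<le> (norm (F1 0) + L1 * u2) * (u2 + r)"
      using F norm_triangle_ineq4[of "w k" x] u2[OF x] r(2)[of k]
      by (intro mult_mono) (auto intro: order_trans[OF norm_ge_zero])
    finally have I: "- inner (F1 x) (w k - x) \<le> (norm (F1 0) + L1 * u2) * (u2 + r)" .
    have "B * norm (w k) \<le> B * r" using AB(1) r(2) by (rule mult_left_mono[rotated])
    then have "A - B * r \<le> val g1 (w k)" using AB(2)[of "w k"] run.w_in_D[OF k] by simp
    then show ?thesis using I g1_U2[OF x] unfolding C_def rbifun_def by linarith
  qed
  define M where "M = max 1 ((r + u1)\<^sup>2 + 1/2 * (2 * r)\<^sup>2)"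
  have M: "run.energy x k \<le> M" if "x \<in> U1" "k \<ge> 1" for x k
    using run.energy_le_of_bounded[OF r(2,3) u1[OF that(1)] that(2)] by (simp add: M_def)
  define C2 C1 B1 where "C2 = C * (1 + b)" and "C1 = M * (1 + b) / (2 * t)" and "B1 = norm p + 1"
  have pos: "C2 > 0" "C1 > 0" "B1 > 0"
    using \<open>b > 0\<close> \<open>0 < t\<close> by (auto simp: C2_def C1_def B1_def C_def M_def less_max_iff_disj
        intro!: mult_pos_pos divide_pos_pos add_nonneg_pos)
  define bound where "bound K = (SUP x\<in>U2. (norm (z 1 - x))\<^sup>2) / (2 * real K * t)
      + a * C2 / ((1 - \<delta>) * (real K + b) powr \<delta>)" for K
  \<comment> \<open>The averaged sums have the denominator \<open>K\<close>, the claimed rates have \<open>K + b\<close>; a factor \<open>1 + b\<close> pays for this.\<close>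
  have shift: "(real K + b) / real K \<le> 1 + b" if "K \<ge> 1" for K
  proof -
    have "b \<le> b * real K" using that \<open>b > 0\<close> by simp
    then show ?thesis using that by (simp add: field_simps)
  qed
  have split: "real K + b = (real K + b) powr \<delta> * (real K + b) powr (1 - \<delta>)" for K
    using \<open>b > 0\<close> by (simp flip: powr_add)
  have feas: "rbifun F2 g2 (zbar K) x \<le> bound K" if K: "K \<ge> 1" and x: "x \<in> U2" for K x
  proof -
    have "bdd_above ((\<lambda>x. (norm (z 1 - x))\<^sup>2) ` U2)"
      by (intro bounded_imp_bdd_above compact_imp_bounded compact_continuous_image \<open>compact U2\<close>
          continuous_intros)
    then have "(norm (z 1 - x))\<^sup>2 \<le> (SUP x\<in>U2. (norm (z 1 - x))\<^sup>2)"
      using x by (intro cSUP_upper)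
    then have 1: "(norm (z 1 - x))\<^sup>2 / (2 * real K * t) \<le> (SUP x\<in>U2. (norm (z 1 - x))\<^sup>2) / (2 * real K * t)"
      using \<open>0 < t\<close> by (intro divide_right_mono) auto
    have "(\<Sum>k=1..K. \<sigma> k) = a * (\<Sum>k=1..K. 1 / (real k + b) powr \<delta>)"
      by (simp add: \<sigma> sum_distrib_left)
    also have "\<dots> \<le> a * ((real K + b) powr (1 - \<delta>) / (1 - \<delta>))"
      using sum_inverse_powr_le[OF \<open>b > 0\<close> \<open>0 < \<delta>\<close> \<open>\<delta> < 1\<close>] \<open>a > 0\<close> by (intro mult_left_mono) auto
    finally have "(\<Sum>k=1..K. \<sigma> k) / real K \<le> a * ((real K + b) powr (1 - \<delta>) / (1 - \<delta>)) / real K"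
      by (intro divide_right_mono) auto
    also have "\<dots> = a / ((1 - \<delta>) * (real K + b) powr \<delta>) * ((real K + b) / real K)"
    proof -
      have "a * (Y / (1 - \<delta>)) / real K = a / ((1 - \<delta>) * X) * (X * Y / real K)" if "X > 0" for X Y
        using that by simp
      from this[of "(real K + b) powr \<delta>" "(real K + b) powr (1 - \<delta>)"] show ?thesis
        using \<open>b > 0\<close> by (simp flip: split)
    qed
    also have "\<dots> \<le> a / ((1 - \<delta>) * (real K + b) powr \<delta>) * (1 + b)"
      using shift[OF K] \<open>a > 0\<close> \<open>\<delta> < 1\<close> by (intro mult_left_mono) auto
    finally have "C * ((\<Sum>k=1..K. \<sigma> k) / real K) \<le> C * (a / ((1 - \<delta>) * (real K + b) powr \<delta>) * (1 + b))"
      by (intro mult_left_mono) (auto simp: C_def)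
    then have "C * (\<Sum>k=1..K. \<sigma> k) / real K \<le> a * C2 / ((1 - \<delta>) * (real K + b) powr \<delta>)"
      by (simp add: C2_def mult_ac)
    moreover have "rbifun F2 g2 (zbar K) x \<le> (norm (z 1 - x))\<^sup>2 / (2 * real K * t) + C * (\<Sum>k=1..K. \<sigma> k) / real K"
      unfolding zbar_eq using x \<open>U2 \<subseteq> run.D\<close> by (intro run.feasibility_bound K C) auto
    ultimately show ?thesis using 1 unfolding bound_def by linarith
  qed
  have gap2: "gap F2 g2 U2 (zbar K) \<le> ereal (bound K)" if K: "K \<ge> 1" for K
    unfolding gap_def
  proof (rule SUP_least)
    fix x assume x: "x \<in> U2"
    then have "bifun F2 g2 (zbar K) x = ereal (rbifun F2 g2 (zbar K) x)"
      using run.zbar_in_D[OF K] \<open>U2 \<subseteq> run.D\<close> by (intro bifun_eq_rbifun[OF g2]) (auto simp: zbar_eq)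
    then show "bifun F2 g2 (zbar K) x \<le> ereal (bound K)" using feas[OF K x] by simp
  qed
  have bifun1: "bifun F1 g1 (zbar K) x = ereal (rbifun F1 g1 (zbar K) x)" if "K \<ge> 1" "x \<in> U1" for K x
    using run.zbar_in_D[OF that(1)] \<open>U1 \<subseteq> run.D\<close> that by (intro bifun_eq_rbifun[OF g1]) (auto simp: zbar_eq)
  have gap1: "gap F1 g1 (U1 \<inter> S2) (zbar K) \<le> ereal (C1 / (a * (real K + b) powr (1 - \<delta>)))" if K: "K \<ge> 1" for K
    unfolding gap_def
  proof (rule SUP_least)
    fix x assume x: "x \<in> U1 \<inter> S2"
    have "rbifun F1 g1 (zbar K) x \<le> M / (2 * t * real K * \<sigma> K)"
      unfolding zbar_eq using x \<open>U1 \<subseteq> run.D\<close> S2 by (intro run.optimality_bound K M) auto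
    also have "\<dots> = M / (2 * t * a * (real K + b) powr (1 - \<delta>)) * ((real K + b) / real K)"
    proof -
      have "M / (2 * t * real K * (a / X)) = M / (2 * t * a * Y) * (X * Y / real K)" if "X > 0" "Y > 0" for X Y
        using that by (simp add: mult_ac)
      from this[of "(real K + b) powr \<delta>" "(real K + b) powr (1 - \<delta>)"] show ?thesis
        using \<open>b > 0\<close> by (simp add: \<sigma> flip: split)
    qed
    also have "\<dots> \<le> M / (2 * t * a * (real K + b) powr (1 - \<delta>)) * (1 + b)"
      using shift[OF K] \<open>a > 0\<close> \<open>0 < t\<close> by (intro mult_left_mono) (auto simp: M_def)
    also have "\<dots> = C1 / (a * (real K + b) powr (1 - \<delta>))" by (simp add: C1_def mult_ac)
    finally show "bifun F1 g1 (zbar K) x \<le> ereal (C1 / (a * (real K + b) powr (1 - \<delta>)))"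
      using bifun1[OF K, of x] x by simp
  qed
  \<comment> \<open>
    Weak sharpness turns the feasibility bound into a bound on the distance to \<open>S2\<close>. The
    solution \<open>y\<close> is admissible in the optimality gap, and there the multiplier \<open>p\<close> lets the
    bifunction be negative only in proportion to that distance.
  \<close>
  have lower: "ereal (- B1 * (bound K / (\<alpha> / \<rho>)) powr (1 / \<rho>)) \<le> gap F1 g1 (U1 \<inter> S2) (zbar K)"
    if ws: "weakly_sharp F2 g2 \<alpha> \<rho>" and ne: "U2 \<inter> S2 \<noteq> {}" and K: "K \<ge> 1" for \<alpha> \<rho> K
  proof -
    obtain s where s: "s \<in> U2" "s \<in> S2" using ne by blast
    have \<alpha>\<rho>: "\<alpha> > 0" "\<rho> \<ge> 1" using ws by (auto simp: weakly_sharp_def)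
    define d where "d = infdist (zbar K) S2"
    have d: "d \<ge> 0" by (simp add: d_def infdist_nonneg)
    have zD: "zbar K \<in> run.D" using run.zbar_in_D[OF K] by (simp add: zbar_eq)
    have "ereal (\<alpha> / \<rho> * d powr \<rho>) \<le> bifun F2 g2 (zbar K) s"
      using ws s zD unfolding weakly_sharp_def d_def S2 by auto
    also have "\<dots> = ereal (rbifun F2 g2 (zbar K) s)"
      using zD s \<open>U2 \<subseteq> run.D\<close> by (intro bifun_eq_rbifun[OF g2]) auto
    finally have "\<alpha> / \<rho> * d powr \<rho> \<le> bound K" using feas[OF K s(1)] by simp
    then have "d powr \<rho> \<le> bound K / (\<alpha> / \<rho>)" using \<alpha>\<rho> by (simp add: field_simps)
    then have "(d powr \<rho>) powr (1 / \<rho>) \<le> (bound K / (\<alpha> / \<rho>)) powr (1 / \<rho>)"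
      using \<alpha>\<rho> by (intro powr_mono2) auto
    then have dle: "d \<le> (bound K / (\<alpha> / \<rho>)) powr (1 / \<rho>)" using d \<alpha>\<rho> by (simp add: powr_powr)
    have "inner p (zbar K - y) \<le> norm p * d"
      unfolding d_def by (rule normal_cone_inner_le_infdist[OF p(3)])
    also have "\<dots> \<le> B1 * (bound K / (\<alpha> / \<rho>)) powr (1 / \<rho>)"
      using dle d by (intro mult_mono) (auto simp: B1_def)
    finally have "- B1 * (bound K / (\<alpha> / \<rho>)) powr (1 / \<rho>) \<le> rbifun F1 g1 (zbar K) y"
      using mult[of "zbar K"] zD by simp
    then have "ereal (- B1 * (bound K / (\<alpha> / \<rho>)) powr (1 / \<rho>)) \<le> bifun F1 g1 (zbar K) y"
      using bifun1[OF K y(1)] by simp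
    also have "\<dots> \<le> gap F1 g1 (U1 \<inter> S2) (zbar K)"
      unfolding gap_def using y p(1) by (intro SUP_upper) auto
    finally show ?thesis .
  qed
  have bound_div: "bound K / q = (SUP x\<in>U2. (norm (z 1 - x))\<^sup>2) / (2 * real K * t * q)
      + a * C2 / (q * (1 - \<delta>) * (real K + b) powr \<delta>)" for K q
    by (simp add: bound_def add_divide_distrib mult_ac)
  show ?thesis
    using pos gap2 gap1 lower unfolding bound_div unfolding bound_def by blast
qed

end
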